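(* For $\tau$ in the upper half-plane and complex $x,y$ with $\theta_1(x|5\tau)\theta_1(y|5\tau)\ne0$, \begin{align*} & q^{5/2}\left(e^{2ix}\theta_1^5(x+\pi\tau|5\tau)-e^{-2ix}\theta_1^5(x-\pi\tau|5\tau)\right)\left(e^{4iy}\theta_1^5(y+2\pi\tau|5\tau)-e^{-4iy}\theta_1^5(y-2\pi\tau|5\tau)\right)\\ &-q^{5/2}\left(e^{2iy}\theta_1^5(y+\pi\tau|5\tau)-e^{-2iy}\theta_1^5(y-\pi\tau|5\tau)\right)\left(e^{4ix}\theta_1^5(x+2\pi\tau|5\tau)-e^{-4ix}\theta_1^5(x-2\pi\tau|5\tau)\right)\\ &=\left(10\eta^4(\tau)\eta^4(5\tau)+\frac{\eta^{10}(\tau)}{\eta^2(5\tau)}\right) \frac{\theta_1(x+y|5\tau)\theta_1(x-y|5\tau)\theta_1(2x|5\tau)\theta_1(2y|5\tau)}{\theta_1(x|5\tau)\theta_1(y|5\tau)}. \end{align*}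
   Context: $q=e^{2\pi i\tau}$, $q^a=e^{2\pi i a\tau}$; $\eta(\tau)=q^{1/24}\prod_{n\ge1}(1-q^n)$; $\theta_1(z|\tau)=2\sum_{n\ge0}(-1)^nq^{(2n+1)^2/8}\sin(2n+1)z$. *)

theory Defs
  imports "HOL-Analysis.Analysis"
begin

text \<open>
  Fractional powers of the nome are read off the variable \<open>\<tau>\<close> and not off \<open>q\<close>, so that
  no branch choice is involved: \<open>q\<^sup>a = exp (2 \<pi> \<i> a \<tau>)\<close>.
\<close>

definition qpow :: "complex \<Rightarrow> real \<Rightarrow> complex" where
  "qpow \<tau> a = exp (2 * of_real pi * \<i> * of_real a * \<tau>)"

definition dedekind_eta :: "complex \<Rightarrow> complex" where
  "dedekind_eta \<tau> = qpow \<tau> (1 / 24) * prodinf (\<lambda>n. 1 - qpow \<tau> (real (Suc n)))"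

definition theta1 :: "complex \<Rightarrow> complex \<Rightarrow> complex" where
  "theta1 z \<tau> =
     2 * (\<Sum>n. (- 1) ^ n * qpow \<tau> ((2 * real n + 1) ^ 2 / 8) * sin ((2 * of_nat n + 1) * z))"

end

theory Submission
  imports Defs "HOL-Computational_Algebra.Primes"
begin

text \<open>
  Put \<open>T = 5\<tau>\<close>. As functions of \<open>x\<close>, both sides are even and lie in the space of theta functions
  of degree 5, odd frequencies and multiplier \<open>-1\<close>; the even part of that space is a plane. Both
  sides are antisymmetric in \<open>x\<close> and \<open>y\<close>, and an alternating form on a plane is unique up to a
  scalar, so they are proportional. The quotient \<open>\<theta>\<^sub>1(2x)/\<theta>\<^sub>1(x)\<close> causes no singularity because the
  quintuple product identity turns it into an everywhere convergent series.

  The scalar is found at \<open>x = \<pi>\<tau>\<close>, \<open>y = 2\<pi>\<tau>\<close>, where everything is expressed by \<open>a = \<theta>\<^sub>1(\<pi>\<tau>|5\<tau>)\<close> and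
  \<open>b = \<theta>\<^sub>1(2\<pi>\<tau>|5\<tau>)\<close>. With \<open>v = q\<^bsup>3/10\<^esup> b/a\<close>, the inverse of the Rogers-Ramanujan continued fraction,
  the claim becomes \<open>v\<^sup>5 - 11 - v\<^bsup>-5\<^esup> = (\<eta>(\<tau>)/\<eta>(5\<tau>))\<^sup>6\<close>. This follows by dissecting the pentagonal
  number series modulo 5, which gives \<open>\<eta>(\<tau>/5) = \<eta>(5\<tau>) (v - 1 - 1/v)\<close>, and multiplying over the
  translates \<open>\<tau> + 24k\<close>, \<open>k < 5\<close>, which replace \<open>v\<close> by its multiples by fifth roots of unity.
\<close>

section \<open>Families indexed by the integers\<close>

lemma has_sum_int_imp_sums:
  fixes f :: "int \<Rightarrow> 'a::real_normed_vector"
  assumes "(f has_sum S) UNIV"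
  shows "(\<lambda>n. f (int n) + f (- int n - 1)) sums S"
proof -
  let ?sgn = "\<lambda>n b. if b then int n else - int n - 1"
  have "(f has_sum S) UNIV \<longleftrightarrow> ((\<lambda>(n, b). f (?sgn n b)) has_sum S) (UNIV \<times> UNIV)"
    by (rule has_sum_reindex_bij_witness[where
        j = "\<lambda>k. (nat (if k \<ge> 0 then k else - k - 1), k \<ge> 0)" and
        i = "\<lambda>(n, b). ?sgn n b"]) (auto split: if_splits)
  hence "((\<lambda>n. f (int n) + f (- int n - 1)) has_sum S) UNIV"
    using assms
    by (intro has_sum_SigmaD[where f = "\<lambda>(n, b). f (?sgn n b)" and B = "\<lambda>_. UNIV"])
       (auto intro!: has_sum_finiteI simp: UNIV_bool)
  thus ?thesis by (rule has_sum_imp_sums)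
qed

lemma has_sum_int_uminus_iff:
  "((\<lambda>n::int. f (- n)) has_sum S) UNIV \<longleftrightarrow> (f has_sum S) UNIV"
  by (rule has_sum_reindex_bij_witness[where i = uminus and j = uminus]) auto

lemma has_sum_int_shift_iff:
  "((\<lambda>n::int. f (n + k)) has_sum S) UNIV \<longleftrightarrow> (f has_sum S) UNIV"
  by (rule has_sum_reindex_bij_witness[where i = "\<lambda>n. n - k" and j = "\<lambda>n. n + k"]) auto

lemma has_sum_residue_classes_iff:
  fixes f :: "int \<Rightarrow> 'a::{topological_comm_monoid_add, t2_space}"
  assumes "m > 0"
  shows "(f has_sum S) UNIV \<longleftrightarrow> ((\<lambda>(j, n). f (m * n + j)) has_sum S) ({a..<a + m} \<times> UNIV)"
proof (rule has_sum_reindex_bij_witness[where i = "\<lambda>(j, n). m * n + j"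
    and j = "\<lambda>n. (a + (n - a) mod m, (n - a) div m)"])
  fix x assume "x \<in> {a..<a + m} \<times> (UNIV :: int set)"
  then obtain j n where x: "x = (j, n)" and j: "0 \<le> j - a" "j - a < m" by (cases x) auto
  have shift: "m * n + j - a = j - a + n * m" by simp
  show "(a + ((case x of (j, n) \<Rightarrow> m * n + j) - a) mod m,
      ((case x of (j, n) \<Rightarrow> m * n + j) - a) div m) = x"
    unfolding x prod.case shift using j assms by simp
qed (use assms in \<open>auto simp: algebra_simps\<close>)

lemma has_sum_residue_classes:
  fixes f :: "int \<Rightarrow> 'a::real_normed_vector"
  assumes "(f has_sum S) UNIV" "m > 0"
    and "\<And>j. j \<in> {a..<a + m} \<Longrightarrow> ((\<lambda>n. f (m * n + j)) has_sum g j) UNIV"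
  shows "S = sum g {a..<a + m}"
proof -
  have "((\<lambda>(j, n). f (m * n + j)) has_sum S) ({a..<a + m} \<times> UNIV)"
    using assms(1) has_sum_residue_classes_iff[OF assms(2)] by blast
  hence "(g has_sum S) {a..<a + m}"
    by (rule has_sum_SigmaD) (use assms(3) in auto)
  thus ?thesis by (metis finite_atLeastLessThan_int has_sum_finite has_sum_unique)
qed

lemma has_sum_Cauchy_product_int:
  fixes f g :: "int \<Rightarrow> complex"
  assumes "(f has_sum a) UNIV" "(g has_sum b) UNIV"
  shows "((\<lambda>(n, k). f k * g (n - k)) has_sum a * b) (UNIV \<times> UNIV)"
proof -
  have "f summable_on UNIV" "g summable_on UNIV"
    using assms has_sum_imp_summable by blast+
  then obtain A B
    where A: "((\<lambda>k. norm (f k)) has_sum A) UNIV" and B: "((\<lambda>k. norm (g k)) has_sum B) UNIV"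
    unfolding summable_on_iff_abs_summable_on_complex summable_on_def by blast
  have "(\<lambda>(k, l). norm (f k) * norm (g l)) summable_on (UNIV \<times> UNIV)"
    by (rule summable_on_SigmaI[where g = "\<lambda>k. norm (f k) * B"])
       (auto intro!: has_sum_cmult_right summable_on_cmult_left B has_sum_imp_summable[OF A])
  hence "(\<lambda>(k, l). f k * g l) summable_on (UNIV \<times> UNIV)"
    by (subst summable_on_iff_abs_summable_on_complex) (simp add: norm_mult case_prod_unfold)
  hence "((\<lambda>(k, l). f k * g l) has_sum a * b) (UNIV \<times> UNIV)"
    by (intro has_sum_SigmaI[where g = "\<lambda>k. f k * b"])
       (auto intro!: has_sum_cmult_right has_sum_cmult_left assms)
  also have "?this \<longleftrightarrow> ?thesis"
    by (rule has_sum_reindex_bij_witness[where i = "\<lambda>(n, k). (k, n - k)"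
          and j = "\<lambda>(k, l). (k + l, k)"]) auto
  finally show ?thesis .
qed

lemma has_sum_dominated_convergence:
  fixes f :: "nat \<Rightarrow> 'b \<Rightarrow> 'a::{banach, second_countable_topology}"
  assumes "\<And>n. (f n has_sum S n) A" "S \<longlonglongrightarrow> l" "h summable_on A"
    and "\<And>n x. x \<in> A \<Longrightarrow> norm (f n x) \<le> h x"
    and "\<And>x. x \<in> A \<Longrightarrow> (\<lambda>n. f n x) \<longlonglongrightarrow> g x"
  shows "(g has_sum l) A"
proof -
  have "h x \<ge> 0" if "x \<in> A" for x
    using assms(4)[OF that] norm_ge_zero order_trans by blast
  hence "(\<lambda>x. norm (h x)) summable_on A"
    using assms(3) by (subst summable_on_cong[of A _ h]) auto
  hence h: "integrable (count_space A) h"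
    unfolding Infinite_Set_Sum.abs_summable_on_def[symmetric] abs_summable_equivalent[symmetric] .
  note dominated = integrable_dominated_convergence[of g "count_space A" f h]
    integrable_dominated_convergence2[of g "count_space A" f h]
    integral_dominated_convergence[of g "count_space A" f h]
  have "Infinite_Set_Sum.abs_summable_on g A" "\<And>n. Infinite_Set_Sum.abs_summable_on (f n) A"
    and lim: "(\<lambda>n. infsetsum (f n) A) \<longlonglongrightarrow> infsetsum g A"
    unfolding Infinite_Set_Sum.abs_summable_on_def infsetsum_def
    by (rule dominated; use assms h in \<open>auto simp: AE_count_space\<close>)+
  hence g: "(g has_sum infsetsum g A) A" and "infsetsum (f n) A = S n" for n
    using assms(1)
    by (auto simp: infsetsum_infsum abs_summable_equivalent[symmetric] abs_summable_summable infsumI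
             intro!: has_sum_infsum)
  hence "S \<longlonglongrightarrow> infsetsum g A" using lim by simp
  hence "infsetsum g A = l" using assms(2) by (rule LIMSEQ_unique)
  thus ?thesis using g by simp
qed

section \<open>The q-binomial theorem\<close>

definition qpoch :: "'a \<Rightarrow> 'a \<Rightarrow> 'a::{real_normed_field, banach}" where
  "qpoch w q = (\<Prod>n. 1 - w * q ^ n)"

lemma convergent_prod_qpoch:
  fixes w q :: "'a::{real_normed_field, banach}"
  assumes "norm q < 1"
  shows "convergent_prod (\<lambda>n. 1 - w * q ^ n)"
proof (intro abs_convergent_prod_imp_convergent_prod summable_imp_abs_convergent_prod)
  have "summable (\<lambda>n. norm w * norm q ^ n)"
    using assms by (intro summable_mult summable_geometric) auto
  thus "summable (\<lambda>n. norm (1 - w * q ^ n - 1))"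
    by (simp add: norm_mult norm_power)
qed

lemma qpoch_LIMSEQ:
  fixes w q :: "'a::{real_normed_field, banach}"
  assumes "norm q < 1"
  shows "(\<lambda>N. \<Prod>n<N. 1 - w * q ^ n) \<longlonglongrightarrow> qpoch w q"
proof -
  have "(\<lambda>N. \<Prod>n\<le>N. 1 - w * q ^ n) \<longlonglongrightarrow> qpoch w q"
    unfolding qpoch_def by (intro convergent_prod_LIMSEQ convergent_prod_qpoch assms)
  thus ?thesis
    by (subst filterlim_sequentially_Suc[symmetric]) (simp add: lessThan_Suc_atMost)
qed

lemma qpoch_nonzero:
  fixes w q :: "'a::{real_normed_field, banach}"
  assumes "norm q < 1" "\<And>n. w * q ^ n \<noteq> 1"
  shows "qpoch w q \<noteq> 0"
  unfolding qpoch_def using assms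
  by (intro prodinf_nonzero convergent_prod_qpoch) auto

lemma mult_power_neq_1:
  fixes w q :: "'a::real_normed_field"
  assumes "norm q < 1" "norm w < 1"
  shows "w * q ^ n \<noteq> 1"
proof
  assume "w * q ^ n = 1"
  hence "norm w * norm q ^ n = 1" by (metis norm_mult norm_one norm_power)
  moreover have "norm w * norm q ^ n \<le> norm w * 1"
    using assms by (intro mult_left_mono power_le_one) auto
  ultimately show False using assms by simp
qed

lemma qpoch_dissection:
  fixes w q :: "'a::{real_normed_field, banach}"
  assumes "norm q < 1" "m > 0"
  shows "qpoch w q = (\<Prod>j<m. qpoch (w * q ^ j) (q ^ m))"
proof (rule LIMSEQ_unique)
  have "norm (q ^ m) < 1"
    using assms by (simp add: norm_power power_less_one_iff)
  thus "(\<lambda>N. \<Prod>j<m. \<Prod>n<N. 1 - w * q ^ j * (q ^ m) ^ n) \<longlonglongrightarrow> (\<Prod>j<m. qpoch (w * q ^ j) (q ^ m))"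
    by (intro tendsto_prod qpoch_LIMSEQ)
next
  have "(\<Prod>n<N * m. 1 - w * q ^ n) = (\<Prod>j<m. \<Prod>n<N. 1 - w * q ^ j * (q ^ m) ^ n)" for N
  proof -
    have "(\<Prod>n<N * m. 1 - w * q ^ n) = (\<Prod>n<N. \<Prod>k\<in>{n * m..<n * m + m}. 1 - w * q ^ k)"
      by (rule prod.nat_group[symmetric])
    also have "\<dots> = (\<Prod>n<N. \<Prod>j<m. 1 - w * q ^ (n * m + j))"
    proof (rule prod.cong[OF refl])
      show "(\<Prod>k\<in>{n * m..<n * m + m}. 1 - w * q ^ k) = (\<Prod>j<m. 1 - w * q ^ (n * m + j))" for n
        by (rule prod.reindex_bij_witness[where j = "\<lambda>k. k - n * m" and i = "\<lambda>j. n * m + j"]) auto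
    qed
    also have "\<dots> = (\<Prod>j<m. \<Prod>n<N. 1 - w * q ^ j * (q ^ m) ^ n)"
      unfolding prod.swap[of _ "{..<N}" "{..<m}"]
      by (intro prod.cong refl) (simp add: power_add power_mult[symmetric] mult_ac)
    finally show ?thesis .
  qed
  moreover have "(\<lambda>N. \<Prod>n<N * m. 1 - w * q ^ n) \<longlonglongrightarrow> qpoch w q"
    by (rule filterlim_compose[OF qpoch_LIMSEQ[OF assms(1)]])
       (use assms(2) in \<open>auto intro!: filterlim_subseq simp: strict_mono_def\<close>)
  ultimately show "(\<lambda>N. \<Prod>j<m. \<Prod>n<N. 1 - w * q ^ j * (q ^ m) ^ n) \<longlonglongrightarrow> qpoch w q"
    by simp
qed

corollary qpoch_self_dissection:
  fixes q :: "'a::{real_normed_field, banach}"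
  assumes "norm q < 1" "m > 0"
  shows "qpoch q q = (\<Prod>j=1..m. qpoch (q ^ j) (q ^ m))"
  using qpoch_dissection[OF assms, of q] by (simp add: prod.atLeast1_atMost_eq)

lemma qpoch_self_nonzero:
  fixes q :: "'a::{real_normed_field, banach}"
  assumes "norm q < 1"
  shows "qpoch q q \<noteq> 0"
  by (intro qpoch_nonzero mult_power_neq_1 assms)

definition qfact :: "'a \<Rightarrow> nat \<Rightarrow> 'a::field" where
  "qfact q n = (\<Prod>i<n. 1 - q * q ^ i)"

definition qbinomial :: "'a \<Rightarrow> nat \<Rightarrow> nat \<Rightarrow> 'a::field" where
  "qbinomial q n k = (if k \<le> n then qfact q n / (qfact q k * qfact q (n - k)) else 0)"

lemma qfact_0 [simp]: "qfact q 0 = 1"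
  by (simp add: qfact_def)

lemma qfact_Suc: "qfact q (Suc n) = qfact q n * (1 - q ^ Suc n)"
  by (simp add: qfact_def)

lemma qfact_nonzero:
  assumes "\<And>n. q ^ Suc n \<noteq> 1"
  shows "qfact q n \<noteq> 0"
  using assms by (auto simp: qfact_def)

lemma qbinomial_0_right:
  assumes "\<And>n. q ^ Suc n \<noteq> 1"
  shows "qbinomial q n 0 = 1"
  using qfact_nonzero[OF assms] by (simp add: qbinomial_def)

lemma qbinomial_Suc_Suc:
  fixes q :: "'a::field"
  assumes q: "\<And>n. q ^ Suc n \<noteq> 1"
  shows "qbinomial q (Suc n) (Suc k) = qbinomial q n (Suc k) + q ^ (n - k) * qbinomial q n k"
proof -
  note nonzero = qfact_nonzero[of q, OF q]
  consider "k > n" | "k = n" | d where "n = Suc (k + d)"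
    by (metis less_iff_Suc_add linorder_neqE_nat)
  thus ?thesis
  proof cases
    case (3 d)
    define X Y where "X = 1 - q ^ Suc k" and "Y = 1 - q ^ Suc d"
    have "X \<noteq> 0" "Y \<noteq> 0" using q[of k] q[of d] by (simp_all add: X_def Y_def)
    have sub: "Suc n - Suc k = Suc d" "n - Suc k = d" "n - k = Suc d"
      using 3 by auto
    have "1 - q ^ Suc n = Y + q ^ Suc d * X"
      unfolding 3 X_def Y_def by (simp add: power_add algebra_simps)
    hence "qbinomial q (Suc n) (Suc k) =
        qfact q n * (Y + q ^ Suc d * X) / ((qfact q k * X) * (qfact q d * Y))"
      unfolding qbinomial_def sub using 3 by (simp add: qfact_Suc X_def Y_def)
    also have "\<dots> = qfact q n / ((qfact q k * X) * qfact q d) +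
        q ^ Suc d * (qfact q n / (qfact q k * (qfact q d * Y)))"
      using nonzero[of k] nonzero[of d] \<open>X \<noteq> 0\<close> \<open>Y \<noteq> 0\<close>
      by (simp del: power_Suc add: divide_simps) (simp add: algebra_simps)
    also have "\<dots> = qbinomial q n (Suc k) + q ^ (n - k) * qbinomial q n k"
      unfolding qbinomial_def sub using 3 by (simp add: qfact_Suc X_def Y_def)
    finally show ?thesis .
  qed (use nonzero in \<open>auto simp: qbinomial_def\<close>)
qed

theorem qbinomial_theorem:
  fixes q z :: "'a::field"
  assumes q: "\<And>n. q ^ Suc n \<noteq> 1"
  shows "(\<Prod>i<n. 1 + z * q ^ i) = (\<Sum>k\<le>n. q ^ (k choose 2) * qbinomial q n k * z ^ k)"
proof (induction n)
  case 0
  thus ?case by (simp add: qbinomial_def numeral_2_eq_2)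
next
  case (Suc n)
  let ?t = "\<lambda>n k. q ^ (k choose 2) * qbinomial q n k * z ^ k"
  have "(\<Sum>k\<le>Suc n. ?t (Suc n) k) = 1 + (\<Sum>k\<le>n. ?t (Suc n) (Suc k))"
    by (subst sum.atMost_Suc_shift) (simp add: qbinomial_0_right[OF q] numeral_2_eq_2)
  also have "(\<Sum>k\<le>n. ?t (Suc n) (Suc k)) = (\<Sum>k\<le>n. ?t n (Suc k) + z * q ^ n * ?t n k)"
  proof (intro sum.cong refl)
    fix k assume "k \<in> {..n}"
    moreover have "Suc k choose 2 = k + (k choose 2)" by (simp add: numeral_2_eq_2)
    ultimately have "q ^ (Suc k choose 2) * q ^ (n - k) = q ^ n * q ^ (k choose 2)"
      by (simp add: power_add[symmetric] add.commute)
    thus "?t (Suc n) (Suc k) = ?t n (Suc k) + z * q ^ n * ?t n k"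
      unfolding qbinomial_Suc_Suc[OF q] by (simp add: algebra_simps)
  qed
  also have "1 + (\<Sum>k\<le>n. ?t n (Suc k) + z * q ^ n * ?t n k) =
      (1 + (\<Sum>k\<le>n. ?t n (Suc k))) + z * q ^ n * (\<Sum>k\<le>n. ?t n k)"
    by (simp add: sum.distrib sum_distrib_left)
  also have "1 + (\<Sum>k\<le>n. ?t n (Suc k)) = (\<Sum>k\<le>Suc n. ?t n k)"
    by (subst sum.atMost_Suc_shift) (simp add: qbinomial_0_right[OF q] numeral_2_eq_2)
  also have "\<dots> = (\<Sum>k\<le>n. ?t n k)" by (simp add: qbinomial_def)
  finally show ?case using Suc.IH by (simp add: algebra_simps)
qed

section \<open>The Jacobi triple product\<close>

lemma summable_on_exp_neg_abs_int: "(\<lambda>n::int. exp (- real_of_int \<bar>n\<bar>)) summable_on UNIV"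
proof -
  have "summable (\<lambda>n::nat. exp (- real n))"
    using summable_geometric[of "exp (-1::real)"] by (simp add: exp_of_nat_mult[symmetric])
  hence "(\<lambda>n::nat. exp (- real n)) summable_on UNIV"
    by (intro summable_nonneg_imp_summable_on) auto
  hence "(\<lambda>n::int. exp (- real_of_int \<bar>n\<bar>)) summable_on range int"
       "(\<lambda>n::int. exp (- real_of_int \<bar>n\<bar>)) summable_on range (\<lambda>n. - int n)"
    by (subst summable_on_reindex; simp add: o_def inj_on_def)+
  hence "(\<lambda>n::int. exp (- real_of_int \<bar>n\<bar>)) summable_on (range int \<union> range (\<lambda>n. - int n))"
    by (rule summable_on_union)
  also have "range int \<union> range (\<lambda>n. - int n) = UNIV"
    by (auto simp: image_iff) (metis int_cases2)
  finally show ?thesis .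
qed

lemma summable_on_exp_quadratic_int:
  fixes b c :: real
  assumes "c > 0"
  shows "(\<lambda>n::int. exp (- c * real_of_int n ^ 2 + b * real_of_int n)) summable_on UNIV"
proof (rule summable_on_comparison_test)
  define K where "K = exp ((\<bar>b\<bar> + 1)\<^sup>2 / (4 * c))"
  show "(\<lambda>n::int. K * exp (- real_of_int \<bar>n\<bar>)) summable_on UNIV"
    by (intro summable_on_cmult_right summable_on_exp_neg_abs_int)
  show "exp (- c * real_of_int n ^ 2 + b * real_of_int n) \<le> K * exp (- real_of_int \<bar>n\<bar>)" for n
  proof -
    define x where "x = real_of_int \<bar>n\<bar>"
    have "b * real_of_int n \<le> \<bar>b\<bar> * x"
      unfolding x_def using abs_ge_self[of "b * real_of_int n"] by (simp add: abs_mult)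
    moreover have "- c * x ^ 2 + (\<bar>b\<bar> + 1) * x \<le> (\<bar>b\<bar> + 1)\<^sup>2 / (4 * c)"
    proof -
      have "0 \<le> (2 * c * x - (\<bar>b\<bar> + 1))\<^sup>2" by simp
      hence "4 * c * (- c * x ^ 2 + (\<bar>b\<bar> + 1) * x) \<le> (\<bar>b\<bar> + 1)\<^sup>2"
        by (simp add: power2_eq_square algebra_simps)
      thus ?thesis using assms by (simp add: field_simps)
    qed
    moreover have "x ^ 2 = real_of_int n ^ 2" by (simp add: x_def)
    ultimately show ?thesis
      unfolding K_def exp_add[symmetric] exp_le_cancel_iff x_def[symmetric]
      by (simp add: algebra_simps)
  qed
qed auto

definition jacobi_term :: "'a \<Rightarrow> 'a \<Rightarrow> int \<Rightarrow> 'a::field" where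
  "jacobi_term q w n = (-1) powi n * q powi (n * (n - 1) div 2) * w powi n"

lemma jacobi_term_add_1:
  fixes q w :: "'a::field"
  assumes "q \<noteq> 0" "w \<noteq> 0"
  shows "jacobi_term q w (n + 1) = - w * q powi n * jacobi_term q w n"
proof -
  have "(n + 1) * (n + 1 - 1) = 2 * n + n * (n - 1)" by (simp add: algebra_simps)
  hence "(n + 1) * (n + 1 - 1) div 2 = n + n * (n - 1) div 2" by simp
  thus ?thesis using assms by (simp add: jacobi_term_def power_int_add)
qed

lemma jacobi_term_0 [simp]: "jacobi_term q w 0 = 1"
  by (simp add: jacobi_term_def)

lemma jacobi_term_summable:
  fixes q w :: complex
  assumes "norm q < 1" "q \<noteq> 0" "w \<noteq> 0"
  shows "jacobi_term q w summable_on UNIV"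
proof -
  let ?c = "- ln (norm q) / 2" and ?b = "ln (norm w) - ln (norm q) / 2"
  have "norm (jacobi_term q w n) = exp (- ?c * real_of_int n ^ 2 + ?b * real_of_int n)" for n
  proof -
    have "even (n * (n - 1))" by simp
    hence half: "real_of_int (n * (n - 1) div 2) = real_of_int n * (real_of_int n - 1) / 2"
      by (simp add: real_of_int_div)
    have "norm (jacobi_term q w n) = norm q powi (n * (n - 1) div 2) * norm w powi n"
      by (simp add: jacobi_term_def norm_mult norm_power_int)
    also have "\<dots> =
        exp (real_of_int (n * (n - 1) div 2) * ln (norm q)) * exp (real_of_int n * ln (norm w))"
      using assms by (simp flip: exp_power_int)
    finally show ?thesis
      unfolding exp_add[symmetric] half
      by (simp add: algebra_simps power2_eq_square diff_divide_distrib)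
  qed
  moreover have "?c > 0" using assms by simp
  ultimately have "(\<lambda>n. norm (jacobi_term q w n)) summable_on UNIV"
    using summable_on_exp_quadratic_int[of ?c ?b] by presburger
  thus ?thesis by (simp add: summable_on_iff_abs_summable_on_complex)
qed

lemma prod_lessThan_double:
  fixes f :: "nat \<Rightarrow> 'a::comm_monoid_mult"
  shows "(\<Prod>i<2 * N. f i) = (\<Prod>i<N. f (N - 1 - i)) * (\<Prod>i<N. f (i + N))"
proof -
  have "(\<Prod>i<N + M. f i) = (\<Prod>i<N. f i) * (\<Prod>i<M. f (i + N))" for M
    by (induction M) (simp_all add: mult_ac add.commute)
  from this[of N] show ?thesis
    using prod.nat_diff_reindex[of f N] by (simp add: mult_2)
qed

lemma jacobi_term_shift:
  fixes q w :: "'a::field"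
  assumes "q \<noteq> 0" "w \<noteq> 0"
  shows "q ^ (k choose 2) * (- w / q ^ N) ^ k =
    (\<Prod>i<N. - w / q ^ Suc i) * jacobi_term q w (int k - int N)"
proof (induction k)
  case 0
  show ?case
  proof (induction N)
    case (Suc N)
    have "jacobi_term q w (- int N) = - w / q ^ Suc N * jacobi_term q w (- int (Suc N))"
      using jacobi_term_add_1[OF assms, of "- int (Suc N)"]
      by (simp add: power_int_minus divide_inverse power_int_diff)
    thus ?case using Suc.IH by (simp add: numeral_2_eq_2 mult_ac)
  qed (simp add: numeral_2_eq_2)
next
  case (Suc k)
  have index: "int (Suc k) - int N = (int k - int N) + 1" by simp
  have "jacobi_term q w (int (Suc k) - int N) =
      (- w / q ^ N) * q ^ k * jacobi_term q w (int k - int N)"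
    unfolding index jacobi_term_add_1[OF assms] using assms by (simp add: power_int_diff)
  moreover have "Suc k choose 2 = k + (k choose 2)" by (simp add: numeral_2_eq_2)
  ultimately show ?case using Suc.IH by (simp add: power_add mult_ac)
qed

lemma finite_jacobi_triple_product:
  fixes q w :: "'a::field"
  assumes "\<And>n. q ^ Suc n \<noteq> 1" "q \<noteq> 0" "w \<noteq> 0"
  shows "(\<Prod>i<N. 1 - w * q ^ i) * (\<Prod>i<N. 1 - q / w * q ^ i) =
         (\<Sum>k\<le>2 * N. jacobi_term q w (int k - int N) * qbinomial q (2 * N) k)"
proof -
  let ?z = "- w / q ^ N" and ?K = "\<Prod>i<N. - w / q ^ Suc i"
  have lower: "(\<Prod>i<N. 1 + ?z * q ^ (N - 1 - i)) = ?K * (\<Prod>i<N. 1 - q / w * q ^ i)"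
    unfolding prod.distrib[symmetric]
  proof (intro prod.cong refl)
    fix i assume "i \<in> {..<N}"
    hence "q ^ N = q ^ (N - 1 - i) * q ^ Suc i" by (subst power_add[symmetric]) auto
    thus "1 + ?z * q ^ (N - 1 - i) = (- w / q ^ Suc i) * (1 - q / w * q ^ i)"
      using assms(2,3) by (simp add: field_simps)
  qed
  have upper: "(\<Prod>i<N. 1 + ?z * q ^ (i + N)) = (\<Prod>i<N. 1 - w * q ^ i)"
    using assms(2) by (intro prod.cong) (simp_all add: power_add field_simps)
  have "?K * ((\<Prod>i<N. 1 - w * q ^ i) * (\<Prod>i<N. 1 - q / w * q ^ i)) = (\<Prod>i<2 * N. 1 + ?z * q ^ i)"
    unfolding prod_lessThan_double lower upper by (simp only: mult_ac)
  also have "\<dots> = (\<Sum>k\<le>2 * N. q ^ (k choose 2) * qbinomial q (2 * N) k * ?z ^ k)"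
    by (rule qbinomial_theorem[OF assms(1)])
  also have "\<dots> = ?K * (\<Sum>k\<le>2 * N. jacobi_term q w (int k - int N) * qbinomial q (2 * N) k)"
    unfolding sum_distrib_left using jacobi_term_shift[OF assms(2,3), of _ N]
    by (intro sum.cong) (simp_all add: mult_ac)
  finally show ?thesis using assms(2,3) by simp
qed

definition central_qbinomial :: "'a \<Rightarrow> nat \<Rightarrow> int \<Rightarrow> 'a::field" where
  "central_qbinomial q N j = (if \<bar>j\<bar> \<le> int N then qbinomial q (2 * N) (nat (int N + j)) else 0)"

lemma central_qbinomial_eq:
  assumes "\<bar>j\<bar> \<le> int N"
  shows "central_qbinomial q N j =
    qfact q (2 * N) * inverse (qfact q (nat (int N + j))) * inverse (qfact q (nat (int N - j)))"
proof -
  have "nat (int N + j) \<le> 2 * N" "2 * N - nat (int N + j) = nat (int N - j)"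
    using assms by auto
  thus ?thesis using assms by (simp add: central_qbinomial_def qbinomial_def divide_inverse)
qed

lemma qfact_LIMSEQ:
  fixes q :: "'a::{real_normed_field, banach}"
  assumes "norm q < 1"
  shows "qfact q \<longlonglongrightarrow> qpoch q q"
  using qpoch_LIMSEQ[OF assms, of q] by (simp add: qfact_def[abs_def])

lemma inverse_qfact_LIMSEQ:
  fixes q :: "'a::{real_normed_field, banach}"
  assumes "norm q < 1"
  shows "(\<lambda>n. inverse (qfact q n)) \<longlonglongrightarrow> inverse (qpoch q q)"
  by (intro tendsto_inverse qfact_LIMSEQ qpoch_self_nonzero assms)

lemma central_qbinomial_bounded:
  fixes q :: "'a::{real_normed_field, banach}"
  assumes "norm q < 1"
  obtains B where "\<And>N j. norm (central_qbinomial q N j) \<le> B"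
proof -
  obtain B1 where B1: "\<And>n. norm (qfact q n) \<le> B1" "B1 > 0"
    using convergent_imp_Bseq[OF convergentI[OF qfact_LIMSEQ[OF assms]]]
    by (auto simp: Bseq_def)
  obtain B2 where B2: "\<And>n. norm (inverse (qfact q n)) \<le> B2" "B2 > 0"
    using convergent_imp_Bseq[OF convergentI[OF inverse_qfact_LIMSEQ[OF assms]]]
    by (auto simp: Bseq_def)
  have "norm (central_qbinomial q N j) \<le> B1 * B2 * B2" for N j
  proof (cases "\<bar>j\<bar> \<le> int N")
    case True
    show ?thesis unfolding central_qbinomial_eq[OF True] norm_mult
      by (intro mult_mono B1 B2) (use B1(2) B2(2) in auto)
  qed (use B1(2) B2(2) in \<open>auto simp: central_qbinomial_def\<close>)
  thus thesis by (rule that)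
qed

lemma central_qbinomial_LIMSEQ:
  fixes q :: "'a::{real_normed_field, banach}"
  assumes "norm q < 1"
  shows "(\<lambda>N. central_qbinomial q N j) \<longlonglongrightarrow> inverse (qpoch q q)"
proof -
  have shift: "filterlim (\<lambda>N. nat (int N + i)) at_top sequentially" for i
    unfolding filterlim_at_top eventually_sequentially
  proof (intro allI exI impI)
    show "Z \<le> nat (int N + i)" if "Z + nat \<bar>i\<bar> \<le> N" for Z N using that by linarith
  qed
  have "filterlim (\<lambda>N. 2 * N :: nat) at_top sequentially"
    by (rule filterlim_subseq) (simp add: strict_mono_def)
  hence "(\<lambda>N. qfact q (2 * N) * inverse (qfact q (nat (int N + j))) *
      inverse (qfact q (nat (int N + - j))))
      \<longlonglongrightarrow> qpoch q q * inverse (qpoch q q) * inverse (qpoch q q)"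
    by (intro tendsto_mult filterlim_compose[OF qfact_LIMSEQ]
        filterlim_compose[OF inverse_qfact_LIMSEQ] shift assms)
  moreover have "qpoch q q \<noteq> 0" by (rule qpoch_self_nonzero[OF assms])
  moreover have "\<forall>\<^sub>F N in sequentially. central_qbinomial q N j =
      qfact q (2 * N) * inverse (qfact q (nat (int N + j))) * inverse (qfact q (nat (int N + - j)))"
    using eventually_ge_at_top[of "nat \<bar>j\<bar>"] by eventually_elim (auto simp: central_qbinomial_eq)
  ultimately show ?thesis by (simp add: tendsto_cong)
qed

theorem jacobi_triple_product:
  fixes q w :: complex
  assumes "norm q < 1" "q \<noteq> 0" "w \<noteq> 0"
  shows "(jacobi_term q w has_sum (qpoch q q * qpoch w q * qpoch (q / w) q)) UNIV"
proof -
  have q: "q ^ Suc n \<noteq> 1" for n using mult_power_neq_1[OF assms(1,1), of n] by simp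
  obtain B where B: "\<And>N j. norm (central_qbinomial q N j) \<le> B"
    using central_qbinomial_bounded[OF assms(1)] by blast
  have "((\<lambda>j. jacobi_term q w j * inverse (qpoch q q)) has_sum qpoch w q * qpoch (q / w) q) UNIV"
  proof (rule has_sum_dominated_convergence)
    show "((\<lambda>j. jacobi_term q w j * central_qbinomial q N j) has_sum
        (\<Prod>i<N. 1 - w * q ^ i) * (\<Prod>i<N. 1 - q / w * q ^ i)) UNIV" for N
    proof (rule has_sum_finite_neutralI)
      show "(\<Prod>i<N. 1 - w * q ^ i) * (\<Prod>i<N. 1 - q / w * q ^ i) =
          (\<Sum>j\<in>{- int N..int N}. jacobi_term q w j * central_qbinomial q N j)"
        unfolding finite_jacobi_triple_product[OF q assms(2,3)]
        by (rule sum.reindex_bij_witness[where j = "\<lambda>k. int k - int N"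
              and i = "\<lambda>j. nat (int N + j)"]) (auto simp: central_qbinomial_def)
    qed (auto simp: central_qbinomial_def)
    show "(\<lambda>j. norm (jacobi_term q w j) * B) summable_on UNIV"
      using jacobi_term_summable[OF assms]
      by (intro summable_on_cmult_left) (simp add: summable_on_iff_abs_summable_on_complex)
    show "norm (jacobi_term q w j * central_qbinomial q N j) \<le> norm (jacobi_term q w j) * B" for N j
      unfolding norm_mult by (intro mult_left_mono B) auto
    show "(\<lambda>N. (\<Prod>i<N. 1 - w * q ^ i) * (\<Prod>i<N. 1 - q / w * q ^ i)) \<longlonglongrightarrow> qpoch w q * qpoch (q / w) q"
      by (intro tendsto_mult qpoch_LIMSEQ assms(1))
    show "(\<lambda>N. jacobi_term q w j * central_qbinomial q N j)
        \<longlonglongrightarrow> jacobi_term q w j * inverse (qpoch q q)" for j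
      by (intro tendsto_mult tendsto_const central_qbinomial_LIMSEQ assms(1))
  qed
  from has_sum_cmult_left[OF this, of "qpoch q q"]
  have "((\<lambda>j. jacobi_term q w j * inverse (qpoch q q) * qpoch q q) has_sum
      qpoch q q * qpoch w q * qpoch (q / w) q) UNIV"
    by (simp only: mult_ac)
  moreover have "qpoch q q \<noteq> 0" by (rule qpoch_self_nonzero[OF assms(1)])
  ultimately show ?thesis by (simp add: mult.assoc)
qed

section \<open>Powers of the nome\<close>

lemma qpow_0 [simp]: "qpow \<tau> 0 = 1"
  by (simp add: qpow_def)

lemma qpow_nonzero [simp]: "qpow \<tau> a \<noteq> 0"
  by (simp add: qpow_def)

lemma qpow_add: "qpow \<tau> (a + b) = qpow \<tau> a * qpow \<tau> b"
  by (simp add: qpow_def algebra_simps exp_add)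

lemma qpow_uminus: "qpow \<tau> (- a) = inverse (qpow \<tau> a)"
  by (simp add: qpow_def exp_minus)

lemma qpow_power: "qpow \<tau> a ^ n = qpow \<tau> (real n * a)"
  by (simp add: qpow_def mult_ac flip: exp_of_nat_mult)

lemma qpow_power_int: "qpow \<tau> a powi n = qpow \<tau> (real_of_int n * a)"
  by (simp add: qpow_def mult_ac exp_power_int)

lemma qpow_translate: "qpow (\<tau> + \<sigma>) a = qpow \<tau> a * qpow \<sigma> a"
  by (simp add: qpow_def algebra_simps exp_add)

lemma qpow_of_nat_mult: "qpow (of_nat k * \<tau>) a = qpow \<tau> (real k * a)"
  by (simp add: qpow_def mult_ac)

lemma qpow_numeral_mult: "qpow (numeral k * \<tau>) a = qpow \<tau> (numeral k * a)"
  using qpow_of_nat_mult[of "numeral k"] by simp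

lemma qpow_divide_of_nat: "qpow (\<tau> / of_nat k) a = qpow \<tau> (a / real k)"
  by (simp add: qpow_def mult_ac)

lemma qpow_divide_numeral: "qpow (\<tau> / numeral k) a = qpow \<tau> (a / numeral k)"
  using qpow_divide_of_nat[of \<tau> "numeral k"] by simp

lemma exp_i_pi_mult: "exp (\<i> * of_real a * (of_real pi * \<tau>)) = qpow \<tau> (a / 2)"
  by (simp add: qpow_def mult_ac)

lemma norm_qpow_less_1:
  assumes "Im \<tau> > 0" "a > 0"
  shows "norm (qpow \<tau> a) < 1"
  using assms by (simp add: qpow_def)

lemma qpow_of_real_eq_1_iff: "qpow (of_real c) a = 1 \<longleftrightarrow> a * c \<in> \<int>"
proof -
  have "qpow (of_real c) a = exp (of_real (2 * pi * (a * c)) * \<i>)"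
    by (simp add: qpow_def mult_ac)
  also have "\<dots> = 1 \<longleftrightarrow> (\<exists>n. a * c = of_int n)"
    by (auto simp: exp_eq_1)
  finally show ?thesis by (auto elim: Ints_cases)
qed

section \<open>Spaces of theta functions\<close>

definition theta_term :: "complex \<Rightarrow> nat \<Rightarrow> complex \<Rightarrow> int \<Rightarrow> complex" where
  "theta_term T d x n = qpow T (of_int n ^ 2 / (8 * real d)) * exp (\<i> * of_int n * x)"

text \<open>
  The Gaussian factor of a Fourier coefficient of a theta function of degree \<open>d\<close> is split off, so
  that the functional equation under \<open>x \<mapsto> x + \<pi>T\<close> becomes plain (twisted) periodicity of the
  remaining coefficients \<open>h\<close>; \<open>r\<close> is the parity of the frequencies that occur.
\<close>

definition theta_coeffs ::
    "complex \<Rightarrow> nat \<Rightarrow> complex \<Rightarrow> int \<Rightarrow> (int \<Rightarrow> complex) \<Rightarrow> (complex \<Rightarrow> complex) \<Rightarrow> bool" where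
  "theta_coeffs T d s r h f \<longleftrightarrow> (\<forall>n. h (n + 2 * int d) = s * h n) \<and>
     (\<forall>n. odd (n - r) \<longrightarrow> h n = 0) \<and>
     (\<forall>x. ((\<lambda>n. h n * theta_term T d x n) has_sum f x) UNIV)"

definition theta_space :: "complex \<Rightarrow> nat \<Rightarrow> complex \<Rightarrow> int \<Rightarrow> (complex \<Rightarrow> complex) set" where
  "theta_space T d s r = {f. \<exists>h. theta_coeffs T d s r h f}"

lemma theta_coeffsD:
  assumes "theta_coeffs T d s r h f"
  shows "h (n + 2 * int d) = s * h n" "odd (n - r) \<Longrightarrow> h n = 0"
    "((\<lambda>n. h n * theta_term T d x n) has_sum f x) UNIV"
  using assms unfolding theta_coeffs_def by blast+

lemma theta_spaceI:
  assumes "\<And>n. h (n + 2 * int d) = s * h n" "\<And>n. odd (n - r) \<Longrightarrow> h n = 0"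
    "\<And>x. ((\<lambda>n. h n * theta_term T d x n) has_sum f x) UNIV"
  shows "f \<in> theta_space T d s r"
  using assms unfolding theta_space_def theta_coeffs_def by blast

lemma theta_spaceE:
  assumes "f \<in> theta_space T d s r"
  obtains h where "theta_coeffs T d s r h f"
  using assms unfolding theta_space_def by blast

lemma theta_space_cong_parity:
  assumes "even (r - r')"
  shows "theta_space T d s r = theta_space T d s r'"
proof -
  have "odd (n - r) \<longleftrightarrow> odd (n - r')" for n using assms by presburger
  thus ?thesis unfolding theta_space_def theta_coeffs_def by simp
qed

lemma theta_term_uminus: "theta_term T d (- x) n = theta_term T d x (- n)"
  by (simp add: theta_term_def)

lemma theta_term_add_arg: "theta_term T d (x + y) n = theta_term T d x n * exp (\<i> * of_int n * y)"
  by (simp add: theta_term_def distrib_left exp_add)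

lemma theta_term_shift_index:
  fixes T :: complex and d :: nat and j :: int
  assumes "d > 0"
  defines "y \<equiv> of_real pi * T * of_int j / (2 * of_nat d)"
  shows "exp (\<i> * of_int j * x) * theta_term T d (x + y) n =
    qpow T (- (of_int j ^ 2 / (8 * real d))) * theta_term T d x (n + j)"
proof -
  have "exp (\<i> * of_int n * y) =
      exp (\<i> * of_real (of_int n * of_int j / (2 * real d)) * (of_real pi * T))"
    by (simp add: y_def mult_ac)
  also have "\<dots> = qpow T (of_int n * of_int j / (4 * real d))"
    unfolding exp_i_pi_mult by (simp add: mult_ac)
  finally have "exp (\<i> * of_int j * x) * theta_term T d (x + y) n =
      qpow T (of_int n ^ 2 / (8 * real d) + of_int n * of_int j / (4 * real d)) *
      exp (\<i> * of_int (n + j) * x)"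
    by (simp add: theta_term_add_arg) (simp add: theta_term_def qpow_add algebra_simps exp_add)
  also have "real_of_int n ^ 2 / (8 * real d) + of_int n * of_int j / (4 * real d) =
      - (of_int j ^ 2 / (8 * real d)) + of_int (n + j) ^ 2 / (8 * real d)"
    using assms by (simp add: field_simps power2_eq_square)
  finally show ?thesis unfolding qpow_add theta_term_def by (simp only: mult.assoc)
qed

lemma theta_space_add:
  assumes "f \<in> theta_space T d s r" "g \<in> theta_space T d s r"
  shows "(\<lambda>x. f x + g x) \<in> theta_space T d s r"
proof -
  obtain h where "theta_coeffs T d s r h f"
    using assms(1) by (rule theta_spaceE)
  note h = theta_coeffsD[OF this]
  obtain h' where "theta_coeffs T d s r h' g"
    using assms(2) by (rule theta_spaceE)
  note h' = theta_coeffsD[OF this]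
  show ?thesis
  proof (rule theta_spaceI[where h = "\<lambda>n. h n + h' n"])
    show "((\<lambda>n. (h n + h' n) * theta_term T d x n) has_sum f x + g x) UNIV" for x
      using has_sum_add[OF h(3)[of x] h'(3)[of x]] by (simp add: distrib_right)
  qed (use h h' in \<open>auto simp: distrib_left\<close>)
qed

lemma theta_space_cmult:
  assumes "f \<in> theta_space T d s r"
  shows "(\<lambda>x. c * f x) \<in> theta_space T d s r"
proof -
  obtain h where "theta_coeffs T d s r h f"
    using assms by (rule theta_spaceE)
  note h = theta_coeffsD[OF this]
  show ?thesis
  proof (rule theta_spaceI[where h = "\<lambda>n. c * h n"])
    show "((\<lambda>n. c * h n * theta_term T d x n) has_sum c * f x) UNIV" for x
      using has_sum_cmult_right[OF h(3)[of x], of c] by (simp add: mult_ac)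
  qed (use h in auto)
qed

lemma theta_space_uminus_arg:
  assumes "f \<in> theta_space T d s r" "s \<noteq> 0"
  shows "(\<lambda>x. f (- x)) \<in> theta_space T d (inverse s) r"
proof -
  obtain h where "theta_coeffs T d s r h f"
    using assms(1) by (rule theta_spaceE)
  note h = theta_coeffsD[OF this]
  show ?thesis
  proof (rule theta_spaceI[where h = "\<lambda>n. h (- n)"])
    show "((\<lambda>n. h (- n) * theta_term T d x n) has_sum f (- x)) UNIV" for x
      using h(3)[of "- x"] has_sum_int_uminus_iff[of "\<lambda>n. h n * theta_term T d (- x) n"]
      by (simp add: theta_term_uminus)
    show "h (- (n + 2 * int d)) = inverse s * h (- n)" for n
      using h(1)[of "- n - 2 * int d"] assms(2) by (simp add: field_simps)
    show "h (- n) = 0" if "odd (n - r)" for n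
      using that by (intro h(2)) auto
  qed
qed

lemma theta_space_shift:
  assumes "f \<in> theta_space T d s r"
  shows "(\<lambda>x. f (x + y)) \<in> theta_space T d (s * exp (2 * \<i> * of_nat d * y)) r"
proof -
  obtain h where "theta_coeffs T d s r h f"
    using assms by (rule theta_spaceE)
  note h = theta_coeffsD[OF this]
  show ?thesis
  proof (rule theta_spaceI[where h = "\<lambda>n. h n * exp (\<i> * of_int n * y)"])
    show "((\<lambda>n. h n * exp (\<i> * of_int n * y) * theta_term T d x n) has_sum f (x + y)) UNIV" for x
      using h(3)[of "x + y"] by (simp add: theta_term_add_arg mult_ac)
  qed (use h in \<open>auto simp: exp_add algebra_simps\<close>)
qed

lemma theta_space_quasi_shift:
  assumes "f \<in> theta_space T d s r" "d > 0"
  shows "(\<lambda>x. exp (\<i> * of_int j * x) * f (x + of_real pi * T * of_int j / (2 * of_nat d))) \<in>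
    theta_space T d s (r + j)"
proof -
  obtain h where "theta_coeffs T d s r h f"
    using assms(1) by (rule theta_spaceE)
  note h = theta_coeffsD[OF this]
  define K where "K = qpow T (- (of_int j ^ 2 / (8 * real d)))"
  show ?thesis
  proof (rule theta_spaceI[where h = "\<lambda>n. h (n - j) * K"])
    fix x
    let ?x = "x + of_real pi * T * of_int j / (2 * of_nat d)"
    have "((\<lambda>n. exp (\<i> * of_int j * x) * (h n * theta_term T d ?x n)) has_sum
        exp (\<i> * of_int j * x) * f ?x) UNIV"
      by (intro has_sum_cmult_right h)
    also have "(\<lambda>n. exp (\<i> * of_int j * x) * (h n * theta_term T d ?x n)) =
        (\<lambda>n. h (n + j - j) * K * theta_term T d x (n + j))"
      using theta_term_shift_index[OF assms(2), of j x T] by (simp add: K_def mult_ac fun_eq_iff)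
    finally show "((\<lambda>n. h (n - j) * K * theta_term T d x n) has_sum
        exp (\<i> * of_int j * x) * f ?x) UNIV"
      using has_sum_int_shift_iff[of "\<lambda>n. h (n - j) * K * theta_term T d x n" j] by simp
  next
    show "h (n + 2 * int d - j) * K = s * (h (n - j) * K)" for n
      using h(1)[of "n - j"] by (simp add: algebra_simps)
  next
    show "h (n - j) * K = 0" if "odd (n - (r + j))" for n
      using that h(2)[of "n - j"] by (simp add: algebra_simps)
  qed
qed

lemma twisted_periodic_nat:
  fixes h :: "int \<Rightarrow> 'a::comm_semiring_1"
  assumes "\<And>n. h (n + p) = s * h n"
  shows "h (n + p * int k) = s ^ k * h n"
proof (induction k)
  case (Suc k)
  thus ?case using assms[of "n + p * int k"] by (simp add: algebra_simps)
qed simp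

lemma twisted_periodic_int:
  fixes h :: "int \<Rightarrow> 'a::field"
  assumes "\<And>n. h (n + p) = s * h n" "s \<noteq> 0"
  shows "h (n + p * k) = s powi k * h n"
proof (cases k)
  case (nonneg i)
  thus ?thesis using twisted_periodic_nat[of h, OF assms(1)] by simp
next
  case (neg i)
  have "n = n + p * k + p * int (Suc i)" unfolding neg by (simp add: algebra_simps)
  hence "h n = s ^ Suc i * h (n + p * k)"
    using twisted_periodic_nat[of h, OF assms(1)] by metis
  moreover have "s powi k = inverse (s ^ Suc i)"
    unfolding neg by (simp add: power_int_minus del: of_nat_Suc)
  ultimately show ?thesis using assms(2) by (simp add: field_simps)
qed

lemma theta_space_mult_nat_arg:
  assumes "f \<in> theta_space T d s r" "k > 0"
  shows "(\<lambda>x. f (of_nat k * x)) \<in> theta_space T (k ^ 2 * d) (s ^ k) (int k * r)"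
proof -
  obtain h where "theta_coeffs T d s r h f"
    using assms(1) by (rule theta_spaceE)
  note h = theta_coeffsD[OF this]
  define g where "g = (\<lambda>n. if int k dvd n then h (n div int k) else 0)"
  show ?thesis
  proof (rule theta_spaceI[where h = g])
    show "g (n + 2 * int (k ^ 2 * d)) = s ^ k * g n" for n
    proof (cases "int k dvd n")
      case True
      then obtain m where m: "n = int k * m" by blast
      have "n + 2 * int (k ^ 2 * d) = int k * (m + 2 * int d * int k)"
        by (simp add: m algebra_simps power2_eq_square)
      thus ?thesis using assms(2) by (simp add: g_def m twisted_periodic_nat[of h, OF h(1)])
    next
      case False
      moreover have "int k dvd 2 * int (k ^ 2 * d)" by (simp add: power2_eq_square)
      ultimately show ?thesis using dvd_add_left_iff[of "int k"] by (simp add: g_def)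
    qed
    show "g n = 0" if odd: "odd (n - int k * r)" for n
    proof (cases "int k dvd n")
      case True
      then obtain m where m: "n = int k * m" by blast
      hence "odd (int k * (m - r))" using odd by (simp add: algebra_simps)
      thus ?thesis using h(2)[of m] assms(2) by (simp add: g_def m)
    qed (simp add: g_def)
    show "((\<lambda>n. g n * theta_term T (k ^ 2 * d) x n) has_sum f (of_nat k * x)) UNIV" for x
    proof -
      have "((\<lambda>n. h n * theta_term T d (of_nat k * x) n) has_sum f (of_nat k * x)) UNIV \<longleftrightarrow>
          ((\<lambda>n. g n * theta_term T (k ^ 2 * d) x n) has_sum f (of_nat k * x)) {n. int k dvd n}"
        using assms(2)
        by (intro has_sum_reindex_bij_witness[where i = "\<lambda>n. n div int k" and j = "\<lambda>n. int k * n"])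
           (auto simp: g_def theta_term_def power_mult_distrib mult_ac)
      also have "\<dots> \<longleftrightarrow> ((\<lambda>n. g n * theta_term T (k ^ 2 * d) x n) has_sum f (of_nat k * x)) UNIV"
        by (rule has_sum_cong_neutral) (auto simp: g_def)
      finally show ?thesis using h(3) by simp
    qed
  qed
qed

lemma theta_space_add_int_pi:
  assumes "f \<in> theta_space T d s r"
  shows "f (x + of_int k * of_real pi) = (-1) powi (k * r) * f x"
proof -
  obtain h where "theta_coeffs T d s r h f"
    using assms by (rule theta_spaceE)
  note h = theta_coeffsD[OF this]
  have exp_pi: "exp (\<i> * of_int m * of_real pi) = (-1 :: complex) powi m" for m
  proof -
    have "exp (\<i> * of_int m * of_real pi) = exp (of_int m * (of_real pi * \<i>))"
      by (simp add: mult_ac)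
    thus ?thesis by (simp add: exp_power_int[symmetric])
  qed
  let ?c = "(-1) powi (k * r) :: complex"
  have "h n * theta_term T d (x + of_int k * of_real pi) n = ?c * (h n * theta_term T d x n)" for n
  proof (cases "odd (n - r)")
    case False
    hence "even (n * k) \<longleftrightarrow> even (k * r)" by auto
    hence "(-1) powi (n * k) = ?c"
      by (simp add: power_int_minus_left)
    thus ?thesis
      using exp_pi[of "n * k"] by (simp add: theta_term_add_arg mult_ac)
  qed (simp add: h(2))
  moreover have "((\<lambda>n. ?c * (h n * theta_term T d x n)) has_sum ?c * f x) UNIV"
    by (intro has_sum_cmult_right h(3))
  ultimately have "((\<lambda>n. h n * theta_term T d (x + of_int k * of_real pi) n) has_sum ?c * f x) UNIV"
    by (simp only:)
  thus ?thesis by (rule has_sum_unique[OF h(3)])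
qed

lemma theta_space_quasi_period:
  assumes "f \<in> theta_space T d s r" "s \<noteq> 0" "d > 0"
  shows "f (x + of_real pi * T) =
    inverse s * qpow T (- (real d / 2)) * exp (- 2 * \<i> * of_nat d * x) * f x"
proof -
  obtain h where "theta_coeffs T d s r h f"
    using assms(1) by (rule theta_spaceE)
  note h = theta_coeffsD[OF this]
  let ?c = "inverse s * qpow T (- (real d / 2)) * exp (- 2 * \<i> * of_nat d * x)"
  have "theta_term T d (x + of_real pi * T) n =
      qpow T (- (real d / 2)) * exp (- 2 * \<i> * of_nat d * x) * theta_term T d x (n + 2 * int d)"
    for n
    using theta_term_shift_index[OF assms(3), of "2 * int d" x T n] assms(3)
    by (simp add: field_simps exp_minus power2_eq_square)
  hence "h n * theta_term T d (x + of_real pi * T) n =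
      ?c * (h (n + 2 * int d) * theta_term T d x (n + 2 * int d))" for n
    using assms(2) by (simp add: h(1))
  moreover have "((\<lambda>n. ?c * (h (n + 2 * int d) * theta_term T d x (n + 2 * int d))) has_sum
      ?c * f x) UNIV"
    using h(3)[of x] has_sum_int_shift_iff[of "\<lambda>n. h n * theta_term T d x n" "2 * int d"]
    by (intro has_sum_cmult_right) simp
  ultimately have "((\<lambda>n. h n * theta_term T d (x + of_real pi * T) n) has_sum ?c * f x) UNIV"
    by (simp only:)
  thus ?thesis by (rule has_sum_unique[OF h(3)])
qed

definition theta_conv_weight :: "complex \<Rightarrow> nat \<Rightarrow> nat \<Rightarrow> int \<Rightarrow> int \<Rightarrow> complex" where
  "theta_conv_weight T d d' n k =
     qpow T ((real d' * of_int k - real d * of_int (n - k)) ^ 2 /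
       (8 * real d * real d' * real (d + d')))"

definition theta_conv ::
    "complex \<Rightarrow> nat \<Rightarrow> nat \<Rightarrow> (int \<Rightarrow> complex) \<Rightarrow> (int \<Rightarrow> complex) \<Rightarrow> int \<Rightarrow> complex" where
  "theta_conv T d d' h h' n = (\<Sum>\<^sub>\<infinity>k. h k * h' (n - k) * theta_conv_weight T d d' n k)"

lemma theta_term_mult:
  assumes "d > 0" "d' > 0"
  shows "theta_term T d x k * theta_term T d' x (n - k) =
    theta_conv_weight T d d' n k * theta_term T (d + d') x n"
proof -
  have "real_of_int k ^ 2 / (8 * real d) + of_int (n - k) ^ 2 / (8 * real d') =
      (real d' * of_int k - real d * of_int (n - k)) ^ 2 / (8 * real d * real d' * real (d + d')) +
      of_int n ^ 2 / (8 * real (d + d'))"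
    using assms by (simp add: divide_simps) (simp add: algebra_simps power2_eq_square)
  moreover have "exp (\<i> * of_int k * x) * exp (\<i> * of_int (n - k) * x) = exp (\<i> * of_int n * x)"
    by (simp add: exp_add[symmetric] algebra_simps)
  ultimately show ?thesis
    unfolding theta_term_def theta_conv_weight_def
    by (simp add: qpow_add[symmetric] mult_ac) (simp add: qpow_add mult_ac)
qed

lemma theta_conv_weight_shift:
  "theta_conv_weight T d d' (n + 2 * int (d + d')) (k + 2 * int d) = theta_conv_weight T d d' n k"
  unfolding theta_conv_weight_def
  by (intro arg_cong[where f = "\<lambda>x. qpow T (x ^ 2 / _)"]) (simp add: algebra_simps)

lemma theta_conv_has_sum:
  assumes "d > 0" "d' > 0"
    and f: "\<And>x. ((\<lambda>n. h n * theta_term T d x n) has_sum f x) UNIV"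
    and g: "\<And>x. ((\<lambda>n. h' n * theta_term T d' x n) has_sum g x) UNIV"
  shows "((\<lambda>n. theta_conv T d d' h h' n * theta_term T (d + d') x n) has_sum f x * g x) UNIV"
proof -
  define w where "w = (\<lambda>n k. h k * h' (n - k) * theta_conv_weight T d d' n k)"
  have product: "((\<lambda>(n, k). w n k * theta_term T (d + d') x n) has_sum f x * g x) (UNIV \<times> UNIV)"
    for x
  proof -
    have "w n k * theta_term T (d + d') x n =
        (h k * theta_term T d x k) * (h' (n - k) * theta_term T d' x (n - k))" for n k
      using theta_term_mult[OF assms(1,2), of T x k n] by (simp add: w_def)
    thus ?thesis using has_sum_Cauchy_product_int[OF f g] by (simp only:)
  qed
  have "w n summable_on UNIV" for n
  proof -
    have "(\<lambda>k. w n k * theta_term T (d + d') 0 n) summable_on UNIV"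
      using has_sum_imp_summable[OF product[of 0]] by (rule summable_on_SigmaD1) auto
    moreover have "theta_term T (d + d') 0 n \<noteq> 0" by (simp add: theta_term_def)
    ultimately show ?thesis by (simp add: summable_on_cmult_left')
  qed
  hence "(w n has_sum theta_conv T d d' h h' n) UNIV" for n
    unfolding theta_conv_def w_def by (rule has_sum_infsum)
  hence "((\<lambda>k. w n k * theta_term T (d + d') x n) has_sum
      theta_conv T d d' h h' n * theta_term T (d + d') x n) UNIV" for n
    by (rule has_sum_cmult_left)
  thus ?thesis by (intro has_sum_SigmaD[OF product]) simp
qed

lemma theta_space_mult:
  assumes "f \<in> theta_space T d s r" "g \<in> theta_space T d' s' r'" "d > 0" "d' > 0"
  shows "(\<lambda>x. f x * g x) \<in> theta_space T (d + d') (s * s') (r + r')"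
proof -
  obtain h where "theta_coeffs T d s r h f"
    using assms(1) by (rule theta_spaceE)
  note h = theta_coeffsD[OF this]
  obtain h' where "theta_coeffs T d' s' r' h' g"
    using assms(2) by (rule theta_spaceE)
  note h' = theta_coeffsD[OF this]
  let ?w = "\<lambda>n k. h k * h' (n - k) * theta_conv_weight T d d' n k"
  show ?thesis
  proof (rule theta_spaceI[where h = "theta_conv T d d' h h'"])
    show "((\<lambda>n. theta_conv T d d' h h' n * theta_term T (d + d') x n) has_sum f x * g x) UNIV" for x
      by (rule theta_conv_has_sum[OF assms(3,4) h(3) h'(3)])
  next
    fix n
    have "h' (n + 2 * int (d + d') - (k + 2 * int d)) = s' * h' (n - k)" for k
      using h'(1)[of "n - k"] by (simp add: algebra_simps)
    hence w_shift: "?w (n + 2 * int (d + d')) (k + 2 * int d) = s * s' * ?w n k" for k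
      unfolding theta_conv_weight_shift h(1) by simp
    have "theta_conv T d d' h h' (n + 2 * int (d + d')) =
        (\<Sum>\<^sub>\<infinity>k. ?w (n + 2 * int (d + d')) (k + 2 * int d))"
      unfolding theta_conv_def
      by (rule infsum_reindex_bij_witness[where i = "\<lambda>k. k + 2 * int d"
            and j = "\<lambda>k. k - 2 * int d"]) auto
    also have "\<dots> = s * s' * theta_conv T d d' h h' n"
      unfolding w_shift theta_conv_def by (rule infsum_cmult_right')
    finally show "theta_conv T d d' h h' (n + 2 * int (d + d')) =
        s * s' * theta_conv T d d' h h' n" .
  next
    fix n assume n: "odd (n - (r + r'))"
    have "?w n k = 0" for k
    proof (cases "odd (k - r)")
      case False
      hence "odd (n - k - r')" using n by presburger
      thus ?thesis by (simp add: h'(2))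
    qed (simp add: h(2))
    thus "theta_conv T d d' h h' n = 0" unfolding theta_conv_def by (intro infsum_0)
  qed
qed

lemma theta_space_power:
  assumes "f \<in> theta_space T d s r" "d > 0"
  shows "(\<lambda>x. f x ^ Suc n) \<in> theta_space T (Suc n * d) (s ^ Suc n) (int (Suc n) * r)"
proof (induction n)
  case (Suc n)
  from theta_space_mult[OF assms(1) Suc assms(2)] show ?case
    using assms(2) by (simp add: algebra_simps)
qed (use assms in simp)

section \<open>The theta functions spanning a space\<close>

text \<open>
  Up to normalisation, the theta function with characteristic \<open>j/(2d)\<close>: its frequencies form a
  single residue class modulo \<open>2d\<close>.
\<close>

definition theta_char :: "complex \<Rightarrow> nat \<Rightarrow> complex \<Rightarrow> int \<Rightarrow> complex \<Rightarrow> complex" where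
  "theta_char T d s j x = (\<Sum>\<^sub>\<infinity>m. s powi m * theta_term T d x (2 * int d * m + j))"

lemma theta_term_eq_jacobi_term:
  assumes "d > 0"
  shows "s powi m * theta_term T d x (2 * int d * m + j) = theta_term T d x j *
    jacobi_term (qpow T d) (- s * qpow T ((real d + of_int j) / 2) * exp (2 * \<i> * of_nat d * x)) m"
proof -
  have "even (m * (m - 1))" by simp
  hence half: "real_of_int (m * (m - 1) div 2) = real_of_int m * (real_of_int m - 1) / 2"
    by (simp add: real_of_int_div)
  have "real_of_int (2 * int d * m + j) ^ 2 / (8 * real d) = of_int j ^ 2 / (8 * real d) +
      (of_int (m * (m - 1) div 2) * real d + of_int m * ((real d + of_int j) / 2))"
    unfolding half using assms by (simp add: field_simps power2_eq_square)
  hence nome: "qpow T (real_of_int (2 * int d * m + j) ^ 2 / (8 * real d)) =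
      qpow T (of_int j ^ 2 / (8 * real d)) *
      (qpow T d powi (m * (m - 1) div 2) * qpow T ((real d + of_int j) / 2) powi m)"
    unfolding qpow_power_int qpow_add[symmetric] by simp
  have exponential: "exp (\<i> * of_int (2 * int d * m + j) * x) =
      exp (\<i> * of_int j * x) * exp (2 * \<i> * of_nat d * x) powi m"
    unfolding exp_power_int exp_add[symmetric] by (simp add: algebra_simps)
  have "(-1 :: complex) powi m * (- s) powi m = s powi m"
    by (simp flip: power_int_mult_distrib)
  thus ?thesis
    unfolding theta_term_def nome exponential jacobi_term_def power_int_mult_distrib
    by (simp add: mult_ac)
qed

context
  fixes T s :: complex and d :: nat
  assumes T: "Im T > 0" and s: "s \<noteq> 0" and d: "d > 0"
begin

lemma theta_char_has_sum:
  "((\<lambda>m. s powi m * theta_term T d x (2 * int d * m + j)) has_sum theta_char T d s j x) UNIV"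
proof -
  have "norm (qpow T d) < 1" using T d by (simp add: norm_qpow_less_1)
  thus ?thesis
    unfolding theta_char_def theta_term_eq_jacobi_term[OF d] using s
    by (intro has_sum_infsum summable_on_cmult_right jacobi_term_summable) auto
qed

theorem theta_char_triple_product:
  fixes x :: complex and j :: int
  defines "q \<equiv> qpow T d"
    and "w \<equiv> - s * qpow T ((real d + of_int j) / 2) * exp (2 * \<i> * of_nat d * x)"
  shows "theta_char T d s j x = theta_term T d x j * (qpoch q q * qpoch w q * qpoch (q / w) q)"
proof -
  have "norm q < 1" unfolding q_def using T d by (simp add: norm_qpow_less_1)
  hence "((\<lambda>m. theta_term T d x j * jacobi_term q w m) has_sum
      theta_term T d x j * (qpoch q q * qpoch w q * qpoch (q / w) q)) UNIV"
    using s by (intro has_sum_cmult_right jacobi_triple_product) (simp_all add: q_def w_def)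
  moreover have "((\<lambda>m. theta_term T d x j * jacobi_term q w m) has_sum theta_char T d s j x) UNIV"
    using theta_char_has_sum[of x j] unfolding theta_term_eq_jacobi_term[OF d] q_def w_def .
  ultimately show ?thesis by (rule has_sum_unique[rotated])
qed

lemma theta_char_uminus: "theta_char T d s j (- x) = theta_char T d (inverse s) (- j) x"
  unfolding theta_char_def
  by (rule infsum_reindex_bij_witness[where i = uminus and j = uminus])
     (auto simp: theta_term_uminus power_int_minus power_int_inverse)

lemma theta_char_add_pi_div:
  "theta_char T d s j (x + of_int k * of_real pi / of_nat d) =
    exp (\<i> * of_int (j * k) * of_real pi / of_nat d) * theta_char T d s j x"
proof -
  let ?y = "of_int k * of_real pi / of_nat d"
  let ?c = "exp (\<i> * of_int (j * k) * of_real pi / of_nat d)"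
  have "s powi m * theta_term T d (x + ?y) (2 * int d * m + j) =
      ?c * (s powi m * theta_term T d x (2 * int d * m + j))" for m
  proof -
    have "exp (\<i> * of_int (2 * int d * m + j) * ?y) =
        ?c * exp (\<i> * (of_int (m * k) * (of_real pi * 2)))"
      unfolding exp_add[symmetric] using d by (simp add: field_simps)
    thus ?thesis unfolding theta_term_add_arg exp_2pi_1_int by simp
  qed
  moreover have "((\<lambda>m. ?c * (s powi m * theta_term T d x (2 * int d * m + j))) has_sum
      ?c * theta_char T d s j x) UNIV"
    by (intro has_sum_cmult_right theta_char_has_sum)
  ultimately have "((\<lambda>m. s powi m * theta_term T d (x + ?y) (2 * int d * m + j)) has_sum
      ?c * theta_char T d s j x) UNIV"
    by (simp only:)
  thus ?thesis by (rule has_sum_unique[OF theta_char_has_sum])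
qed

lemma theta_char_add_period: "s * theta_char T d s (j + 2 * int d) x = theta_char T d s j x"
proof -
  have "((\<lambda>m. s * (s powi m * theta_term T d x (2 * int d * m + (j + 2 * int d)))) has_sum
      s * theta_char T d s (j + 2 * int d) x) UNIV"
    by (intro has_sum_cmult_right theta_char_has_sum)
  also have "(\<lambda>m. s * (s powi m * theta_term T d x (2 * int d * m + (j + 2 * int d)))) =
      (\<lambda>m. s powi (m + 1) * theta_term T d x (2 * int d * (m + 1) + j))"
    using s by (simp add: power_int_add algebra_simps)
  finally show ?thesis
    using has_sum_int_shift_iff[of "\<lambda>m. s powi m * theta_term T d x (2 * int d * m + j)" 1]
      theta_char_has_sum has_sum_unique by blast
qed

lemma theta_space_theta_char: "theta_char T d s j \<in> theta_space T d s j"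
proof -
  define h where "h = (\<lambda>n. if 2 * int d dvd n - j then s powi ((n - j) div (2 * int d)) else 0)"
  show ?thesis
  proof (rule theta_spaceI[where h = h])
    show "h (n + 2 * int d) = s * h n" for n
    proof -
      have "n + 2 * int d - j = n - j + 2 * int d" by simp
      thus ?thesis unfolding h_def using s d by (simp only:) (simp add: power_int_add)
    qed
    show "h n = 0" if "odd (n - j)" for n
      using that dvd_trans[of 2 "2 * int d" "n - j"] by (auto simp: h_def)
    show "((\<lambda>n. h n * theta_term T d x n) has_sum theta_char T d s j x) UNIV" for x
    proof -
      have "((\<lambda>m. s powi m * theta_term T d x (2 * int d * m + j)) has_sum
            theta_char T d s j x) UNIV \<longleftrightarrow>
          ((\<lambda>n. h n * theta_term T d x n) has_sum theta_char T d s j x) {n. 2 * int d dvd n - j}"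
        using d by (intro has_sum_reindex_bij_witness[where i = "\<lambda>n. (n - j) div (2 * int d)"
              and j = "\<lambda>m. 2 * int d * m + j"]) (auto simp: h_def)
      also have "\<dots> \<longleftrightarrow> ((\<lambda>n. h n * theta_term T d x n) has_sum theta_char T d s j x) UNIV"
        by (rule has_sum_cong_neutral) (auto simp: h_def)
      finally show ?thesis using theta_char_has_sum by simp
    qed
  qed
qed

lemma theta_space_span:
  assumes "f \<in> theta_space T d s r"
  obtains c where "\<And>j. odd (j - r) \<Longrightarrow> c j = 0"
    "\<And>x. f x = (\<Sum>j\<in>{a..<a + 2 * int d}. c j * theta_char T d s j x)"
proof -
  obtain h where "theta_coeffs T d s r h f"
    using assms by (rule theta_spaceE)
  note h = theta_coeffsD[OF this]
  have "f x = (\<Sum>j\<in>{a..<a + 2 * int d}. h j * theta_char T d s j x)" for x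
  proof (rule has_sum_residue_classes[OF h(3)])
    show "((\<lambda>m. h (2 * int d * m + j) * theta_term T d x (2 * int d * m + j)) has_sum
        h j * theta_char T d s j x) UNIV" for j
      using twisted_periodic_int[of h, OF h(1) s, of j]
        has_sum_cmult_right[OF theta_char_has_sum, of "h j"]
      by (simp add: add.commute mult_ac)
  qed (use d in auto)
  with h(2) show thesis by (rule that)
qed

end

lemma sum_int_fold_uminus:
  fixes f :: "int \<Rightarrow> 'a::comm_monoid_add"
  assumes "n > 0"
  shows "(\<Sum>j\<in>{- n<..n}. f j) = (\<Sum>j\<in>{0..n}. f j + (if j \<in> {0<..<n} then f (- j) else 0))"
proof -
  have "{- n<..n} = {0..n} \<union> {- n<..<0}" using assms by auto
  also have "sum f \<dots> = (\<Sum>j\<in>{0..n}. f j) + (\<Sum>j\<in>{- n<..<0}. f j)"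
    by (rule sum.union_disjoint) auto
  also have "(\<Sum>j\<in>{- n<..<0}. f j) = (\<Sum>j\<in>{0<..<n}. f (- j))"
    by (rule sum.reindex_bij_witness[where i = uminus and j = uminus]) auto
  also have "\<dots> = (\<Sum>j\<in>{0..n}. if j \<in> {0<..<n} then f (- j) else 0)"
    by (intro sum.mono_neutral_cong_left) auto
  finally show ?thesis by (simp only: sum.distrib)
qed

definition symmetric_theta_space ::
    "complex \<Rightarrow> nat \<Rightarrow> complex \<Rightarrow> int \<Rightarrow> complex \<Rightarrow> (complex \<Rightarrow> complex) set" where
  "symmetric_theta_space T d s r e = {f \<in> theta_space T d s r. \<forall>x. f (- x) = e * f x}"

lemma symmetric_theta_space_span:
  assumes "Im T > 0" "d > 0" "s\<^sup>2 = 1" "e\<^sup>2 = 1" "f \<in> symmetric_theta_space T d s r e"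
  obtains c where "\<And>j. odd (j - r) \<Longrightarrow> c j = 0"
    "\<And>x. f x = (\<Sum>j\<in>{0..int d}. c j * (theta_char T d s j x + e * theta_char T d s j (- x)))"
proof -
  have f: "f \<in> theta_space T d s r" "\<And>x. f (- x) = e * f x"
    using assms(5) by (simp_all add: symmetric_theta_space_def)
  have s: "s \<noteq> 0" "inverse s = s" using assms(3) by (auto simp: power2_eq_square inverse_unique)
  have e: "e * e = 1" using assms(4) by (simp add: power2_eq_square)
  define B where "B = (\<lambda>j x. theta_char T d s j x + e * theta_char T d s j (- x))"
  have B_uminus: "B (- j) x = e * B j x" for j x
    using theta_char_uminus[OF assms(1) s(1) assms(2), of "- j" x]
      theta_char_uminus[OF assms(1) s(1) assms(2), of j x] e
    by (simp add: B_def s(2) algebra_simps flip: mult.assoc)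
  have range: "{1 - int d..<1 - int d + 2 * int d} = {- int d<..int d}" by auto
  obtain c where c: "\<And>j. odd (j - r) \<Longrightarrow> c j = 0"
    "\<And>x. f x = (\<Sum>j\<in>{- int d<..int d}. c j * theta_char T d s j x)"
    using theta_space_span[OF assms(1) s(1) assms(2) f(1), of "1 - int d"] unfolding range by blast
  define c' where "c' = (\<lambda>j. (c j + (if j \<in> {0<..<int d} then e * c (- j) else 0)) / 2)"
  show thesis
  proof (rule that)
    show "c' j = 0" if "odd (j - r)" for j
    proof -
      have "odd (- j - r)" using that by presburger
      thus ?thesis using that c(1) by (simp add: c'_def)
    qed
    fix x
    have "2 * f x = f x + e * f (- x)" using f(2) e by (simp flip: mult.assoc)
    also have "\<dots> = (\<Sum>j\<in>{- int d<..int d}. c j * B j x)"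
      unfolding c(2) by (simp add: B_def algebra_simps sum.distrib sum_distrib_left)
    also have "\<dots> = (\<Sum>j\<in>{0..int d}. c j * B j x +
        (if j \<in> {0<..<int d} then c (- j) * B (- j) x else 0))"
      using assms(2) by (intro sum_int_fold_uminus) simp
    also have "\<dots> = 2 * (\<Sum>j\<in>{0..int d}. c' j * B j x)"
      unfolding sum_distrib_left by (intro sum.cong) (auto simp: c'_def B_uminus field_simps)
    finally show "f x =
        (\<Sum>j\<in>{0..int d}. c' j * (theta_char T d s j x + e * theta_char T d s j (- x)))"
      by (simp add: B_def)
  qed
qed

lemma theta_char_uminus_arg_self:
  assumes "Im T > 0" "d > 0" "s\<^sup>2 = 1"
  shows "theta_char T d s 0 (- x) = theta_char T d s 0 x"
    and "theta_char T d s (int d) (- x) = s * theta_char T d s (int d) x"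
proof -
  have s: "s \<noteq> 0" "inverse s = s" using assms(3) by (auto simp: power2_eq_square inverse_unique)
  note T = assms(1) s(1) assms(2)
  show "theta_char T d s 0 (- x) = theta_char T d s 0 x"
    using theta_char_uminus[OF T, of 0] s(2) by simp
  show "theta_char T d s (int d) (- x) = s * theta_char T d s (int d) x"
    using theta_char_uminus[OF T, of "int d"] theta_char_add_period[OF T, of "- int d"] s(2) by simp
qed

lemma odd_theta_space_4_line:
  assumes "Im T > 0"
  obtains p where "\<And>f. f \<in> symmetric_theta_space T 4 1 0 (-1) \<Longrightarrow> \<exists>c. \<forall>x. f x = c * p x"
proof
  fix f assume f: "f \<in> symmetric_theta_space T 4 1 0 (-1)"
  note symmetry = theta_char_uminus_arg_self[OF assms, of 4 1, simplified]
  obtain c where c: "\<And>j. odd j \<Longrightarrow> c j = 0"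
    "\<And>x. f x = (\<Sum>j\<in>{0..4}. c j * (theta_char T 4 1 j x - theta_char T 4 1 j (- x)))"
    by (rule symmetric_theta_space_span[OF assms _ _ _ f]) auto
  have "{0..4} = {0, 1, 2, 3, 4 :: int}" by auto
  hence "f x = c 2 * (theta_char T 4 1 2 x - theta_char T 4 1 2 (- x))" for x
    using c(2)[of x] by (simp add: symmetry c(1))
  thus "\<exists>c. \<forall>x. f x = c * (theta_char T 4 1 2 x - theta_char T 4 1 2 (- x))" by blast
qed

lemma even_theta_space_5_plane:
  assumes "Im T > 0"
  obtains p r where
    "\<And>f. f \<in> symmetric_theta_space T 5 (-1) 1 1 \<Longrightarrow> \<exists>\<alpha> \<beta>. \<forall>x. f x = \<alpha> * p x + \<beta> * r x"
proof
  fix f assume f: "f \<in> symmetric_theta_space T 5 (-1) 1 1"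
  note symmetry = theta_char_uminus_arg_self(2)[OF assms, of 5 "-1", simplified]
  let ?B = "\<lambda>j x. theta_char T 5 (-1) j x + theta_char T 5 (-1) j (- x)"
  obtain c where c: "\<And>j. even j \<Longrightarrow> c j = 0" "\<And>x. f x = (\<Sum>j\<in>{0..5}. c j * ?B j x)"
    by (rule symmetric_theta_space_span[OF assms _ _ _ f]) auto
  have "{0..5} = {0, 1, 2, 3, 4, 5 :: int}" by auto
  hence "f x = c 1 * ?B 1 x + c 3 * ?B 3 x" for x
    using c(2)[of x] by (simp add: symmetry c(1))
  thus "\<exists>\<alpha> \<beta>. \<forall>x. f x = \<alpha> * ?B 1 x + \<beta> * ?B 3 x" by blast
qed

section \<open>The function theta1\<close>

lemma theta1_eq_theta_char:
  assumes "Im T > 0"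
  shows "theta1 z T = - \<i> * theta_char T 1 (-1) 1 z"
proof -
  let ?f = "\<lambda>m. (-1) powi m * theta_term T 1 z (2 * int 1 * m + 1)"
  let ?g = "\<lambda>n. (- 1) ^ n * qpow T ((2 * real n + 1) ^ 2 / 8) * sin ((2 * of_nat n + 1) * z)"
  have "?f (int n) + ?f (- int n - 1) = 2 * \<i> * ?g n" for n
  proof -
    let ?Q = "qpow T ((2 * real n + 1) ^ 2 / 8)" and ?y = "(2 * of_nat n + 1) * z"
    have index: "2 * (- int n - 1) + 1 = - (2 * int n + 1)" by simp
    have "(-1 :: complex) powi (- int n - 1) = - ((-1) ^ n)"
      by (simp add: power_int_minus_left)
    hence "?f (- int n - 1) = - ((-1) ^ n * ?Q * exp (- (\<i> * ?y)))"
      by (simp only: of_nat_1 mult_1_right index theta_term_uminus[symmetric])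
         (simp add: theta_term_def mult_ac)
    moreover have "?f (int n) = (-1) ^ n * ?Q * exp (\<i> * ?y)"
      by (simp add: theta_term_def mult_ac)
    ultimately show ?thesis unfolding sin_exp_eq by (simp add: field_simps)
  qed
  moreover have "(\<lambda>n. ?f (int n) + ?f (- int n - 1)) sums theta_char T 1 (-1) 1 z"
    using assms by (intro has_sum_int_imp_sums theta_char_has_sum) auto
  ultimately have "(\<lambda>n. - \<i> * (2 * \<i> * ?g n)) sums (- \<i> * theta_char T 1 (-1) 1 z)"
    by (intro sums_mult) simp
  moreover have "- \<i> * (2 * \<i> * t) = 2 * t" for t by (simp add: complex_eq_iff)
  ultimately have "(\<lambda>n. 2 * ?g n) sums (- \<i> * theta_char T 1 (-1) 1 z)"
    by (simp only:)
  from sums_divide[OF this, of 2] have "?g sums (- \<i> * theta_char T 1 (-1) 1 z / 2)"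
    by simp
  hence "suminf ?g = - \<i> * theta_char T 1 (-1) 1 z / 2" by (rule sums_unique[symmetric])
  thus ?thesis unfolding theta1_def by (simp only:) simp
qed

lemma theta_space_theta1:
  assumes "Im T > 0"
  shows "(\<lambda>x. theta1 x T) \<in> theta_space T 1 (-1) 1"
  unfolding theta1_eq_theta_char[OF assms] using assms
  by (intro theta_space_cmult theta_space_theta_char) auto

lemma theta1_uminus:
  assumes "Im T > 0"
  shows "theta1 (- z) T = - theta1 z T"
  unfolding theta1_eq_theta_char[OF assms]
  using assms theta_char_uminus_arg_self(2)[of T 1 "-1" z] by simp

lemma theta1_0:
  assumes "Im T > 0"
  shows "theta1 0 T = 0"
  using theta1_uminus[OF assms, of 0] by simp

lemma theta1_add_int_pi:
  assumes "Im T > 0"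
  shows "theta1 (z + of_int k * of_real pi) T = (-1) powi k * theta1 z T"
  using theta_space_add_int_pi[OF theta_space_theta1[OF assms], of z k] by simp

lemma theta1_pi_mult_minus:
  assumes "Im T > 0"
  shows "theta1 (of_real pi * T - z) T = qpow T (- 1 / 2) * exp (2 * \<i> * z) * theta1 z T"
  using theta_space_quasi_period[OF theta_space_theta1[OF assms], of "- z"]
  by (simp add: theta1_uminus[OF assms] add.commute)

lemma theta1_add_8_int: "theta1 z (T + 8 * of_int k) = theta1 z T"
proof -
  have "qpow (T + 8 * of_int k) ((2 * real n + 1) ^ 2 / 8) = qpow T ((2 * real n + 1) ^ 2 / 8)"
    for n
  proof -
    have "(2 * real n + 1) ^ 2 / 8 * (8 * of_int k) = of_int ((2 * int n + 1) ^ 2 * k)"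
      by simp
    hence "qpow (of_real (8 * of_int k)) ((2 * real n + 1) ^ 2 / 8) = 1"
      unfolding qpow_of_real_eq_1_iff by (simp only: Ints_of_int)
    thus ?thesis by (simp add: qpow_translate)
  qed
  thus ?thesis by (simp add: theta1_def)
qed

theorem theta1_triple_product:
  fixes T z :: complex
  assumes "Im T > 0"
  defines "q \<equiv> qpow T 1" and "w \<equiv> exp (2 * \<i> * z)"
  shows "theta1 z T = - \<i> * qpow T (1 / 8) * exp (\<i> * z) *
    (qpoch q q * qpoch (q * w) q * qpoch (1 / w) q)"
  unfolding theta1_eq_theta_char[OF assms(1)] using assms theta_char_triple_product[of T "-1" 1 1 z]
  by (simp add: theta_term_def mult.assoc)

lemma theta1_nonzero:
  assumes "Im T > 0" "Im z \<ge> 0" "Im z < pi * Im T" "exp (2 * \<i> * z) \<noteq> 1"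
  shows "theta1 z T \<noteq> 0"
proof -
  define q where "q = qpow T 1"
  define w where "w = exp (2 * \<i> * z)"
  have q: "norm q < 1" using assms(1) by (simp add: q_def norm_qpow_less_1)
  have w: "norm w \<le> 1" "norm q < norm w" "w \<noteq> 0"
    using assms by (simp_all add: q_def w_def qpow_def)
  have "norm (q * w) < 1"
    using mult_mono[of "norm q" "norm q" "norm w" 1] w q by (simp add: norm_mult)
  hence "q * w * q ^ n \<noteq> 1" for n using q by (intro mult_power_neq_1)
  moreover have "1 / w * q ^ n \<noteq> 1" for n
  proof (cases n)
    case 0
    thus ?thesis using assms(4) by (simp add: w_def)
  next
    case (Suc m)
    have "norm (q / w) < 1" using w by (simp add: norm_divide)
    hence "q / w * q ^ m \<noteq> 1" by (intro mult_power_neq_1 q)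
    thus ?thesis using Suc by (simp add: field_simps)
  qed
  ultimately have "qpoch q q * qpoch (q * w) q * qpoch (1 / w) q \<noteq> 0"
    using qpoch_nonzero[OF q] qpoch_self_nonzero[OF q] by simp
  thus ?thesis unfolding theta1_triple_product[OF assms(1)] q_def w_def by simp
qed

section \<open>The Dedekind eta function\<close>

lemma dedekind_eta_qpoch: "dedekind_eta \<tau> = qpow \<tau> (1 / 24) * qpoch (qpow \<tau> 1) (qpow \<tau> 1)"
proof -
  have "qpow \<tau> (real (Suc n)) = qpow \<tau> 1 * qpow \<tau> 1 ^ n" for n
    by (simp add: qpow_power qpow_add)
  thus ?thesis unfolding dedekind_eta_def qpoch_def by simp
qed

lemma dedekind_eta_nonzero:
  assumes "Im \<tau> > 0"
  shows "dedekind_eta \<tau> \<noteq> 0"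
  using assms by (simp add: dedekind_eta_qpoch qpoch_self_nonzero norm_qpow_less_1)

lemma dedekind_eta_add_24_nat: "dedekind_eta (\<tau> + 24 * of_nat k) = dedekind_eta \<tau>"
proof -
  have "qpow (of_real (24 * real k)) (1 / 24) = 1" "qpow (of_real (24 * real k)) 1 = 1"
    unfolding qpow_of_real_eq_1_iff by simp_all
  thus ?thesis by (simp add: dedekind_eta_qpoch qpow_translate)
qed

theorem pentagonal_number_theorem:
  assumes "Im T > 0"
  shows "dedekind_eta T = theta_char T 3 (-1) 1 0"
proof -
  define q where "q = qpow T 1"
  have q: "norm q < 1" "q \<noteq> 0" using assms by (simp_all add: q_def norm_qpow_less_1)
  have powers: "qpow T 3 = q ^ 3" "qpow T 2 = q ^ 2" "q ^ 3 / q ^ 2 = q"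
    using q by (simp_all add: q_def qpow_power field_simps eval_nat_numeral flip: qpow_add)
  have "qpoch q q = qpoch q (q ^ 3) * qpoch (q ^ 2) (q ^ 3) * qpoch (q ^ 3) (q ^ 3)"
    using qpoch_self_dissection[of q 3] q by (simp add: eval_nat_numeral mult_ac)
  thus ?thesis
    using theta_char_triple_product[of T "-1" 3 1 0] assms powers
    by (simp add: dedekind_eta_qpoch theta_term_def q_def mult_ac)
qed

section \<open>The quintuple product\<close>

definition quintuple_series :: "complex \<Rightarrow> complex \<Rightarrow> complex" where
  "quintuple_series T x = theta_char T 3 (-1) 1 x + theta_char T 3 (-1) 1 (- x)"

lemma quintuple_series_uminus: "quintuple_series T (- x) = quintuple_series T x"
  by (simp add: quintuple_series_def add.commute)

lemma theta_space_quintuple_series: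
  assumes "Im T > 0"
  shows "quintuple_series T \<in> theta_space T 3 (-1) 1"
proof -
  have char: "theta_char T 3 (-1) 1 \<in> theta_space T 3 (-1) 1"
    using assms by (intro theta_space_theta_char) auto
  have "(\<lambda>x. theta_char T 3 (-1) 1 (- x)) \<in> theta_space T 3 (-1) 1"
    using theta_space_uminus_arg[OF char] by simp
  from theta_space_add[OF char this] show ?thesis
    by (simp add: quintuple_series_def[abs_def])
qed

lemma quintuple_series_pi_3:
  assumes "Im T > 0"
  shows "quintuple_series T (of_real pi / 3) = dedekind_eta T"
proof -
  let ?z = "of_real pi / 3 :: complex"
  have "theta_char T 3 (-1) 1 (of_int k * of_real pi / of_nat 3) =
      exp (\<i> * of_int k * ?z) * dedekind_eta T" for k
    using theta_char_add_pi_div[of T "-1" 3 1 0 k] assms by (simp add: pentagonal_number_theorem)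
  from this[of 1] this[of "-1"]
  have "quintuple_series T ?z = (exp (\<i> * ?z) + exp (- (\<i> * ?z))) * dedekind_eta T"
    by (simp add: quintuple_series_def distrib_right)
  also have "exp (\<i> * ?z) + exp (- (\<i> * ?z)) = 2 * cos (of_real (pi / 3))"
    unfolding cos_exp_eq by simp
  also have "cos (of_real (pi / 3) :: complex) = 1 / 2"
    unfolding cos_of_real by (simp add: cos_60)
  finally show ?thesis by simp
qed

lemma theta1_pi_3_nonzero:
  assumes "Im T > 0"
  shows "theta1 (of_real pi / 3) T \<noteq> 0"
proof (rule theta1_nonzero[OF assms])
  have "sin (2 * pi / 3) \<noteq> 0" using sin_gt_zero[of "2 * pi / 3"] by simp
  moreover have "Im (exp (2 * \<i> * (of_real pi / 3))) = sin (2 * pi / 3)"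
    by (simp add: Im_exp)
  ultimately show "exp (2 * \<i> * (of_real pi / 3)) \<noteq> (1 :: complex)" by fastforce
qed (use assms in auto)

theorem quintuple_product_identity:
  assumes "Im T > 0"
  shows "theta1 x T * quintuple_series T x = dedekind_eta T * theta1 (2 * x) T"
proof -
  define f where "f = (\<lambda>x. theta1 x T * quintuple_series T x)"
  define g where "g = (\<lambda>x. theta1 (2 * x) T)"
  have "f \<in> theta_space T (1 + 3) (-1 * -1) (1 + 1)"
    unfolding f_def
    by (intro theta_space_mult theta_space_theta1 theta_space_quintuple_series assms) auto
  hence "f \<in> theta_space T 4 1 0" using theta_space_cong_parity[of 2 0 T 4 1] by simp
  hence f: "f \<in> symmetric_theta_space T 4 1 0 (-1)"
    by (simp add: symmetric_theta_space_def f_def theta1_uminus[OF assms] quintuple_series_uminus)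
  have "g \<in> theta_space T 4 1 0"
    using theta_space_mult_nat_arg[OF theta_space_theta1[OF assms], of 2]
      theta_space_cong_parity[of 2 0 T 4 1]
    by (simp add: g_def)
  hence g: "g \<in> symmetric_theta_space T 4 1 0 (-1)"
    by (simp add: symmetric_theta_space_def g_def theta1_uminus[OF assms])
  obtain p where p: "\<And>f. f \<in> symmetric_theta_space T 4 1 0 (-1) \<Longrightarrow> \<exists>c. \<forall>x. f x = c * p x"
    using odd_theta_space_4_line[OF assms] by blast
  obtain a b where "\<forall>x. f x = a * p x" "\<forall>x. g x = b * p x" using p[OF f] p[OF g] by blast
  hence proportional: "f x * g z = f z * g x" for z by simp
  let ?z = "of_real pi / 3 :: complex"
  have "2 * ?z = - ?z + of_int 1 * of_real pi" by (simp add: field_simps)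
  hence "g ?z = theta1 ?z T"
    unfolding g_def by (simp only: theta1_add_int_pi[OF assms] theta1_uminus[OF assms]) simp
  thus ?thesis
    using proportional[of ?z] theta1_pi_3_nonzero[OF assms] quintuple_series_pi_3[OF assms]
    by (simp add: f_def g_def)
qed

section \<open>Values of theta1 at the points of order five\<close>

definition theta1_div5 :: "complex \<Rightarrow> int \<Rightarrow> complex" where
  "theta1_div5 \<tau> k = theta1 (of_int k * of_real pi * \<tau>) (5 * \<tau>)"

lemma exp_2_i_multiple_pi_tau: "exp (2 * \<i> * (of_int k * of_real pi * \<tau>)) = qpow \<tau> (real_of_int k)"
  by (simp add: qpow_def mult_ac)

lemma theta1_div5_0:
  assumes "Im \<tau> > 0"
  shows "theta1_div5 \<tau> 0 = 0"
  using assms by (simp add: theta1_div5_def theta1_0)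

lemma theta1_div5_uminus:
  assumes "Im \<tau> > 0"
  shows "theta1_div5 \<tau> (- k) = - theta1_div5 \<tau> k"
  using assms theta1_uminus[of "5 * \<tau>"] by (simp add: theta1_div5_def)

lemma theta1_div5_reflect:
  assumes "Im \<tau> > 0"
  shows "theta1_div5 \<tau> (5 - k) = qpow \<tau> (real_of_int k - 5 / 2) * theta1_div5 \<tau> k"
proof -
  have "of_int (5 - k) * of_real pi * \<tau> = of_real pi * (5 * \<tau>) - of_int k * of_real pi * \<tau>"
    by (simp add: algebra_simps)
  hence "theta1_div5 \<tau> (5 - k) = qpow (5 * \<tau>) (- 1 / 2) * qpow \<tau> (real_of_int k) * theta1_div5 \<tau> k"
    unfolding theta1_div5_def using assms theta1_pi_mult_minus[of "5 * \<tau>"]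
    by (simp add: exp_2_i_multiple_pi_tau)
  also have "qpow (5 * \<tau>) (- 1 / 2) * qpow \<tau> (real_of_int k) = qpow \<tau> (real_of_int k - 5 / 2)"
    unfolding qpow_numeral_mult qpow_add[symmetric] by (rule arg_cong) simp
  finally show ?thesis .
qed

lemma theta1_div5_nonzero:
  assumes "Im \<tau> > 0" "0 < k" "k < 5"
  shows "theta1_div5 \<tau> k \<noteq> 0"
  unfolding theta1_div5_def
proof (rule theta1_nonzero)
  have "norm (qpow \<tau> (real_of_int k)) \<noteq> 1"
    using norm_qpow_less_1[of \<tau> "real_of_int k"] assms by simp
  thus "exp (2 * \<i> * (of_int k * of_real pi * \<tau>)) \<noteq> 1" unfolding exp_2_i_multiple_pi_tau by auto
qed (use assms in auto)

lemma quintuple_series_div5: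
  assumes "Im \<tau> > 0"
  shows "quintuple_series (5 * \<tau>) (of_real pi * \<tau>) =
      dedekind_eta (5 * \<tau>) * theta1_div5 \<tau> 2 / theta1_div5 \<tau> 1"
    and "quintuple_series (5 * \<tau>) (2 * of_real pi * \<tau>) =
      dedekind_eta (5 * \<tau>) * qpow \<tau> (- 3 / 2) * theta1_div5 \<tau> 1 / theta1_div5 \<tau> 2"
proof -
  have "theta1_div5 \<tau> k * quintuple_series (5 * \<tau>) (of_int k * of_real pi * \<tau>) =
      dedekind_eta (5 * \<tau>) * theta1_div5 \<tau> (2 * k)" for k
    using quintuple_product_identity[of "5 * \<tau>" "of_int k * of_real pi * \<tau>"] assms
    by (simp add: theta1_div5_def mult.assoc)
  from this[of 1] this[of 2] show
    "quintuple_series (5 * \<tau>) (of_real pi * \<tau>) =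
      dedekind_eta (5 * \<tau>) * theta1_div5 \<tau> 2 / theta1_div5 \<tau> 1"
    "quintuple_series (5 * \<tau>) (2 * of_real pi * \<tau>) =
      dedekind_eta (5 * \<tau>) * qpow \<tau> (- 3 / 2) * theta1_div5 \<tau> 1 / theta1_div5 \<tau> 2"
    using theta1_div5_nonzero[OF assms, of 1] theta1_div5_nonzero[OF assms, of 2]
      theta1_div5_reflect[OF assms, of 1] by (simp_all add: field_simps)
qed

lemma theta1_div5_product:
  assumes "Im \<tau> > 0"
  defines "q \<equiv> qpow \<tau> 1"
  shows "theta1_div5 \<tau> (int k) = \<i> * qpow \<tau> (5 / 8 - real k / 2) *
    (qpoch (q ^ 5) (q ^ 5) * qpoch (qpow \<tau> (5 - real k)) (q ^ 5) * qpoch (q ^ k) (q ^ 5))"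
proof -
  let ?z = "of_int (int k) * of_real pi * \<tau>"
  have q_powers: "q ^ 5 = qpow (5 * \<tau>) 1" "q ^ k = qpow \<tau> (real k)"
    by (simp_all add: q_def qpow_power qpow_numeral_mult)
  have w: "exp (2 * \<i> * - ?z) = qpow \<tau> (- real k)"
    using exp_2_i_multiple_pi_tau[of "- int k" \<tau>] by simp
  have "exp (\<i> * - ?z) = qpow \<tau> (- real k / 2)"
    using exp_i_pi_mult[of "- real k" \<tau>] by (simp add: mult.assoc)
  hence prefactor: "qpow (5 * \<tau>) (1 / 8) * exp (\<i> * - ?z) = qpow \<tau> (5 / 8 - real k / 2)"
    unfolding qpow_numeral_mult by (simp add: algebra_simps flip: qpow_add)
  have "theta1_div5 \<tau> (int k) = - theta1 (- ?z) (5 * \<tau>)"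
    using assms theta1_uminus[of "5 * \<tau>"] by (simp add: theta1_div5_def)
  also have "\<dots> = \<i> * (qpow (5 * \<tau>) (1 / 8) * exp (\<i> * - ?z)) * (qpoch (q ^ 5) (q ^ 5) *
      qpoch (qpow (5 * \<tau>) 1 * qpow \<tau> (- real k)) (q ^ 5) * qpoch (1 / qpow \<tau> (- real k)) (q ^ 5))"
    using assms theta1_triple_product[of "5 * \<tau>" "- ?z"] unfolding w q_powers by simp
  also have "qpow (5 * \<tau>) 1 * qpow \<tau> (- real k) = qpow \<tau> (5 - real k)"
    by (simp add: qpow_numeral_mult flip: qpow_add)
  also have "1 / qpow \<tau> (- real k) = q ^ k"
    by (simp add: q_powers qpow_uminus divide_inverse)
  finally show ?thesis unfolding prefactor .
qed

lemma theta1_div5_1_mult_2: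
  assumes "Im \<tau> > 0"
  shows "theta1_div5 \<tau> 1 * theta1_div5 \<tau> 2 =
    - qpow \<tau> (- 1 / 2) * dedekind_eta \<tau> * dedekind_eta (5 * \<tau>)"
proof -
  define q where "q = qpow \<tau> 1"
  have q: "norm q < 1" using assms by (simp add: q_def norm_qpow_less_1)
  have q_powers: "qpow \<tau> 4 = q ^ 4" "qpow \<tau> 3 = q ^ 3" "qpow (5 * \<tau>) 1 = q ^ 5"
    by (simp_all add: q_def qpow_power qpow_numeral_mult)
  have dissection: "qpoch q q = qpoch q (q ^ 5) * qpoch (q ^ 2) (q ^ 5) * qpoch (q ^ 3) (q ^ 5) *
      qpoch (q ^ 4) (q ^ 5) * qpoch (q ^ 5) (q ^ 5)"
    using qpoch_self_dissection[OF q, of 5] by (simp add: eval_nat_numeral)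
  have "theta1_div5 \<tau> 1 * theta1_div5 \<tau> 2 = (\<i> * \<i>) * (qpow \<tau> (1 / 8) * qpow \<tau> (- 3 / 8)) *
      (qpoch q q * qpoch (q ^ 5) (q ^ 5))"
    using theta1_div5_product[OF assms, of 1] theta1_div5_product[OF assms, of 2]
    unfolding dissection by (simp add: q_powers mult_ac flip: q_def)
  also have "qpow \<tau> (1 / 8) * qpow \<tau> (- 3 / 8) =
      qpow \<tau> (- 1 / 2) * (qpow \<tau> (1 / 24) * qpow (5 * \<tau>) (1 / 24))"
    by (simp add: qpow_numeral_mult flip: qpow_add)
  finally show ?thesis unfolding dedekind_eta_qpoch q_powers q_def[symmetric] by (simp add: mult_ac)
qed

section \<open>Products over roots of unity of prime order\<close>

lemma inj_on_power_root_of_unity: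
  fixes \<omega> :: "'a::idom"
  assumes "prime p" "\<omega> ^ p = 1" "\<omega> \<noteq> 1"
  shows "inj_on (\<lambda>k. \<omega> ^ k) {..<p}"
proof (rule linorder_inj_onI)
  fix a b :: nat assume ab: "a < b" "b \<in> {..<p}"
  have "\<omega> ^ (b - a) \<noteq> 1"
  proof
    assume one: "\<omega> ^ (b - a) = 1"
    have "coprime p (b - a)"
      using ab assms(1) by (intro prime_imp_coprime) (auto dest: dvd_imp_le)
    then obtain i j where "(b - a) * i = p * j + 1"
      using bezout_nat[of "b - a" p] ab by (auto simp: coprime_iff_gcd_eq_1 gcd.commute)
    hence "(\<omega> ^ (b - a)) ^ i = (\<omega> ^ p) ^ j * \<omega>"
      by (simp flip: power_mult)
    thus False using one assms(2,3) by simp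
  qed
  moreover have "\<omega> ^ b = \<omega> ^ a * \<omega> ^ (b - a)" using ab by (simp flip: power_add)
  moreover have "\<omega> \<noteq> 0" using assms(2) prime_gt_0_nat[OF assms(1)] by (auto simp: power_0_left)
  ultimately show "\<omega> ^ a \<noteq> \<omega> ^ b" by simp
qed auto

lemma prod_minus_power_root_of_unity:
  fixes \<omega> x c :: "'a::idom"
  assumes "prime p" "\<omega> ^ p = 1" "\<omega> \<noteq> 1"
  shows "(\<Prod>k<p. c - \<omega> ^ k * x) = c ^ p - x ^ p"
proof (cases "x = 0")
  case False
  define P where "P = (\<Prod>k<p. [:- (\<omega> ^ k * x), 1:])"
  define Q where "Q = monom 1 p - [:x ^ p:]"
  have p: "p > 0" using assms(1) by (rule prime_gt_0_nat)
  have degree_P: "degree P = p" by (simp add: P_def degree_prod_sum_eq)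
  have "P = Q"
  proof (rule poly_eqI_degree_lead_coeff)
    have "lead_coeff P = 1" unfolding P_def lead_coeff_prod by simp
    thus "coeff P p = coeff Q p" using degree_P p by (simp add: Q_def coeff_pCons split: nat.split)
    show "degree Q \<le> p"
      unfolding Q_def by (intro degree_diff_le degree_monom_le) simp
    have "inj_on (\<lambda>k. \<omega> ^ k * x) {..<p}"
      using inj_on_power_root_of_unity[OF assms] False by (simp add: inj_on_def)
    thus "p \<le> card ((\<lambda>k. \<omega> ^ k * x) ` {..<p})" by (simp add: card_image)
    fix z assume "z \<in> (\<lambda>k. \<omega> ^ k * x) ` {..<p}"
    then obtain k where k: "k < p" "z = \<omega> ^ k * x" by auto
    have "(\<omega> ^ k) ^ p = (\<omega> ^ p) ^ k" by (simp add: mult.commute flip: power_mult)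
    hence "poly Q z = 0" using assms(2) k by (simp add: Q_def poly_monom power_mult_distrib)
    moreover have "poly P z = 0" using k by (auto simp: P_def poly_prod)
    ultimately show "poly P z = poly Q z" by simp
  qed (simp add: degree_P)
  hence "poly P c = poly Q c" by simp
  thus ?thesis by (simp add: P_def Q_def poly_prod poly_monom)
qed (use prime_gt_0_nat[OF assms(1)] in \<open>simp add: power_0_left\<close>)

lemma prod_qpoch_root_of_unity:
  fixes \<omega> x q :: "'a::{real_normed_field, banach}"
  assumes "prime p" "\<omega> ^ p = 1" "\<omega> \<noteq> 1" "norm q < 1"
  shows "(\<Prod>k<p. qpoch (\<omega> ^ k * x) q) = qpoch (x ^ p) (q ^ p)"
proof (rule LIMSEQ_unique)
  show "(\<lambda>N. \<Prod>k<p. \<Prod>n<N. 1 - \<omega> ^ k * x * q ^ n) \<longlonglongrightarrow> (\<Prod>k<p. qpoch (\<omega> ^ k * x) q)"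
    by (intro tendsto_prod qpoch_LIMSEQ assms(4))
  have "(\<Prod>k<p. \<Prod>n<N. 1 - \<omega> ^ k * x * q ^ n) = (\<Prod>n<N. \<Prod>k<p. 1 - \<omega> ^ k * (x * q ^ n))" for N
    by (subst prod.swap) (simp only: mult.assoc)
  also have "\<dots> N = (\<Prod>n<N. 1 - x ^ p * (q ^ p) ^ n)" for N
    unfolding prod_minus_power_root_of_unity[OF assms(1-3)]
    by (simp add: power_mult_distrib mult.commute flip: power_mult)
  finally show "(\<lambda>N. \<Prod>k<p. \<Prod>n<N. 1 - \<omega> ^ k * x * q ^ n) \<longlonglongrightarrow> qpoch (x ^ p) (q ^ p)"
    using qpoch_LIMSEQ[of "q ^ p" "x ^ p"] assms(4) prime_gt_0_nat[OF assms(1)]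
    by (simp add: norm_power power_less_one_iff)
qed

lemma norm_root_of_unity:
  fixes \<omega> :: "'a::real_normed_div_algebra"
  assumes "\<omega> ^ n = 1" "n > 0"
  shows "norm \<omega> = 1"
proof (rule power_eq_imp_eq_base)
  show "norm \<omega> ^ n = 1 ^ n" using assms(1) by (metis norm_one norm_power power_one)
qed (use assms(2) in auto)

lemma qpoch_self_root_of_unity_dissection:
  fixes \<omega> t :: "'a::{real_normed_field, banach}"
  assumes "\<omega> ^ m = 1" "m > 0" "norm t < 1"
  shows "qpoch (\<omega> ^ k * t) (\<omega> ^ k * t) = (\<Prod>j=1..m. qpoch ((\<omega> ^ j) ^ k * t ^ j) (t ^ m))"
proof -
  have "norm (\<omega> ^ k * t) < 1"
    using assms(3) norm_root_of_unity[OF assms(1,2)] by (simp add: norm_mult norm_power)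
  moreover have "(\<omega> ^ k * t) ^ j = (\<omega> ^ j) ^ k * t ^ j" for j
    by (simp add: power_mult_distrib mult.commute flip: power_mult)
  ultimately show ?thesis
    using qpoch_self_dissection[of "\<omega> ^ k * t" m] assms(1,2) by simp
qed

theorem prod_qpoch_self_root_of_unity:
  fixes \<omega> t :: "'a::{real_normed_field, banach}"
  assumes "prime p" "\<omega> ^ p = 1" "\<omega> \<noteq> 1" "norm t < 1"
  defines "q \<equiv> t ^ p"
  shows "(\<Prod>k<p. qpoch (\<omega> ^ k * t) (\<omega> ^ k * t)) * qpoch (q ^ p) (q ^ p) = qpoch q q ^ (p + 1)"
proof -
  note p = prime_gt_0_nat[OF assms(1)]
  have q: "norm q < 1" unfolding q_def using assms(4) p by (simp add: norm_power power_less_one_iff)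
  have power_swap: "(a ^ i) ^ j = (a ^ j) ^ i" for a :: 'a and i j
    by (simp add: mult.commute flip: power_mult)
  define F where "F = (\<lambda>j. \<Prod>k<p. qpoch ((\<omega> ^ j) ^ k * t ^ j) q)"
  have "(\<Prod>k<p. qpoch (\<omega> ^ k * t) (\<omega> ^ k * t)) = (\<Prod>j=1..p. F j)"
    unfolding F_def q_def qpoch_self_root_of_unity_dissection[OF assms(2) p assms(4)]
    by (rule prod.swap)
  also have "{1..p} = insert p {1..<p}" using p by auto
  also have "prod F \<dots> = F p * (\<Prod>j\<in>{1..<p}. F j)" by simp
  also have "F p = qpoch q q ^ p" using assms(2) by (simp add: F_def q_def)
  also have "(\<Prod>j\<in>{1..<p}. F j) = (\<Prod>j\<in>{1..<p}. qpoch (q ^ j) (q ^ p))"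
  proof (rule prod.cong[OF refl])
    fix j assume j: "j \<in> {1..<p}"
    hence "\<omega> ^ j \<noteq> \<omega> ^ 0"
      using inj_onD[OF inj_on_power_root_of_unity[OF assms(1-3)], of j 0] by auto
    moreover have "(\<omega> ^ j) ^ p = 1" using assms(2) by (simp only: power_swap[of \<omega> j] power_one)
    ultimately have "F j = qpoch ((t ^ j) ^ p) (q ^ p)"
      unfolding F_def by (intro prod_qpoch_root_of_unity assms(1) q) auto
    thus "F j = qpoch (q ^ j) (q ^ p)" by (simp only: power_swap[of t j] q_def)
  qed
  finally have "(\<Prod>k<p. qpoch (\<omega> ^ k * t) (\<omega> ^ k * t)) * qpoch (q ^ p) (q ^ p) =
      qpoch q q ^ p * (\<Prod>j\<in>insert p {1..<p}. qpoch (q ^ j) (q ^ p))"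
    by (simp add: mult_ac)
  also have "insert p {1..<p} = {1..p}" using p by auto
  also have "(\<Prod>j=1..p. qpoch (q ^ j) (q ^ p)) = qpoch q q"
    using qpoch_self_dissection[OF q p] by simp
  finally show ?thesis by simp
qed

lemma qpow_24_root_of_unity:
  assumes "prime p" "p > 3"
  shows "qpow (of_real 24) (1 / real p) ^ p = 1" "qpow (of_real 24) (1 / real p) \<noteq> 1"
proof -
  have p: "p > 0" using assms(2) by simp
  show "qpow (of_real 24) (1 / real p) ^ p = 1"
    unfolding qpow_power qpow_of_real_eq_1_iff using p by simp
  show "qpow (of_real 24) (1 / real p) \<noteq> 1"
  proof
    assume "qpow (of_real 24) (1 / real p) = 1"
    then obtain n where "1 / real p * 24 = of_int n"
      unfolding qpow_of_real_eq_1_iff by (elim Ints_cases)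
    hence "real_of_int (int p * n) = real_of_int 24" using p by (simp add: field_simps)
    hence "int p dvd int 24" unfolding of_int_eq_iff by (metis dvd_triv_left of_nat_numeral)
    hence "p dvd 2 ^ 3 * 3" by (simp only: int_dvd_int_iff) simp
    hence "p dvd 2 \<or> p dvd 3" using assms(1) prime_dvd_mult_iff prime_dvd_power by blast
    thus False using assms(2) by (auto dest: dvd_imp_le)
  qed
qed

lemma qpow_translate_24_divide:
  "qpow ((\<tau> + 24 * of_nat k) / of_nat m) a =
    qpow (of_real 24) (a / real m) ^ k * qpow \<tau> (a / real m)"
  using qpow_of_nat_mult[of k 24]
  by (simp add: qpow_divide_of_nat qpow_translate qpow_power mult.commute)

lemma prod_qpow_translate_24:
  assumes "odd m"
  shows "(\<Prod>k<m. qpow ((\<tau> + 24 * of_nat k) / of_nat m) (1 / 24)) = qpow \<tau> (1 / 24)"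
proof -
  obtain l where l: "m = 2 * l + 1" using assms by (elim oddE)
  hence "m > 0" by simp
  have "(\<Prod>k<m. qpow (of_real 24) (1 / 24 / real m) ^ k) =
      qpow (of_real 24) (real (\<Sum>k<m. k) * (1 / 24 / real m))"
    unfolding power_sum[symmetric] by (rule qpow_power)
  moreover have "(\<Sum>k<m. k) = m * l"
    using Sum_Ico_nat[of 0 m] by (simp add: l atLeast0LessThan)
  hence "real (\<Sum>k<m. k) * (1 / 24 / real m) * 24 = real l" using \<open>m > 0\<close> by simp
  hence "qpow (of_real 24) (real (\<Sum>k<m. k) * (1 / 24 / real m)) = 1"
    unfolding qpow_of_real_eq_1_iff by (metis Ints_of_nat)
  ultimately show ?thesis
    using \<open>m > 0\<close> unfolding qpow_translate_24_divide prod.distrib by (simp add: qpow_power)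
qed

theorem prod_dedekind_eta_translates:
  assumes "Im \<tau> > 0" "prime p" "p > 3"
  shows "(\<Prod>k<p. dedekind_eta ((\<tau> + 24 * of_nat k) / of_nat p)) * dedekind_eta (of_nat p * \<tau>) =
    dedekind_eta \<tau> ^ (p + 1)"
proof -
  define \<omega> where "\<omega> = qpow (of_real 24) (1 / real p)"
  define t where "t = qpow \<tau> (1 / real p)"
  have p: "p > 0" "odd p" using assms(2,3) by (simp_all add: prime_odd_nat)
  have t: "norm t < 1" "t ^ p = qpow \<tau> 1" "(t ^ p) ^ p = qpow (of_nat p * \<tau>) 1"
    using assms(1) p(1) by (simp_all add: t_def norm_qpow_less_1 qpow_power qpow_of_nat_mult)
  have nome: "qpow ((\<tau> + 24 * of_nat k) / of_nat p) 1 = \<omega> ^ k * t" for k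
    unfolding qpow_translate_24_divide \<omega>_def t_def ..
  have "(\<Prod>k<p. dedekind_eta ((\<tau> + 24 * of_nat k) / of_nat p)) * dedekind_eta (of_nat p * \<tau>) =
      (qpow \<tau> (1 / 24) * qpow (of_nat p * \<tau>) (1 / 24)) *
      ((\<Prod>k<p. qpoch (\<omega> ^ k * t) (\<omega> ^ k * t)) * qpoch ((t ^ p) ^ p) ((t ^ p) ^ p))"
    unfolding dedekind_eta_qpoch prod.distrib nome prod_qpow_translate_24[OF p(2)] t(3)
    by (simp only: mult_ac)
  also have "qpow \<tau> (1 / 24) * qpow (of_nat p * \<tau>) (1 / 24) = qpow \<tau> (1 / 24) ^ (p + 1)"
    unfolding qpow_of_nat_mult qpow_power qpow_add[symmetric] by (simp add: field_simps)
  also have "(\<Prod>k<p. qpoch (\<omega> ^ k * t) (\<omega> ^ k * t)) * qpoch ((t ^ p) ^ p) ((t ^ p) ^ p) =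
      qpoch (t ^ p) (t ^ p) ^ (p + 1)"
    unfolding \<omega>_def using assms(2,3) t(1)
    by (intro prod_qpoch_self_root_of_unity qpow_24_root_of_unity)
  finally show ?thesis unfolding dedekind_eta_qpoch t(2) power_mult_distrib .
qed

section \<open>The fifth power of the Rogers-Ramanujan continued fraction\<close>

definition inverse_rogers_ramanujan :: "complex \<Rightarrow> complex" where
  "inverse_rogers_ramanujan \<tau> = qpow \<tau> (3 / 10) * theta1_div5 \<tau> 2 / theta1_div5 \<tau> 1"

lemma inverse_rogers_ramanujan_nonzero:
  assumes "Im \<tau> > 0"
  shows "inverse_rogers_ramanujan \<tau> \<noteq> 0"
  using theta1_div5_nonzero[OF assms] by (simp add: inverse_rogers_ramanujan_def)

lemma theta_term_dissection_5:
  "theta_term (\<tau> / 5) 3 0 (5 * n + 6 * j) =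
    qpow \<tau> (3 * real_of_int j ^ 2 / 10) * theta_term (5 * \<tau>) 3 (of_int j * of_real pi * \<tau>) n"
proof -
  have "exp (\<i> * of_int n * (of_int j * of_real pi * \<tau>)) = qpow \<tau> (of_int n * of_int j / 2)"
    using exp_i_pi_mult[of "of_int n * of_int j" \<tau>] by (simp add: mult_ac)
  hence "qpow \<tau> (3 * real_of_int j ^ 2 / 10) * theta_term (5 * \<tau>) 3 (of_int j * of_real pi * \<tau>) n =
      qpow \<tau> (3 * real_of_int j ^ 2 / 10 + (5 * (of_int n ^ 2 / 24) + of_int n * of_int j / 2))"
    by (simp add: theta_term_def qpow_numeral_mult qpow_add)
  also have "3 * real_of_int j ^ 2 / 10 + (5 * (of_int n ^ 2 / 24) + of_int n * of_int j / 2) =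
      of_int (5 * n + 6 * j) ^ 2 / 24 / 5"
    by (simp add: field_simps power2_eq_square)
  finally show ?thesis by (simp add: theta_term_def qpow_divide_numeral)
qed

lemma dedekind_eta_div_5_theta_char:
  assumes "Im \<tau> > 0"
  shows "dedekind_eta (\<tau> / 5) =
    (\<Sum>j\<in>{-2..2::int}. (-1) powi (j + 1) * qpow \<tau> (3 * real_of_int j ^ 2 / 10) *
      theta_char (5 * \<tau>) 3 (-1) (-1) (of_int j * of_real pi * \<tau>))"
proof -
  let ?F = "\<lambda>m. (-1) powi m * theta_term (\<tau> / 5) 3 0 (6 * m + 1)"
  let ?c = "\<lambda>j. (-1) powi (j + 1) * qpow \<tau> (3 * real_of_int j ^ 2 / 10)"
  let ?x = "\<lambda>j. of_int j * of_real pi * \<tau>"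
  let ?\<theta> = "\<lambda>j. theta_char (5 * \<tau>) 3 (-1) (-1) (?x j)"
  have F_residue: "?F (5 * m + i) =
      ?c (i + 1) * ((-1) powi m * theta_term (5 * \<tau>) 3 (?x (i + 1)) (6 * m - 1))" for i m
  proof -
    have sign: "(-1 :: complex) powi (5 * m + i) = (-1) powi (i + 1 + 1) * (-1) powi m"
      by (simp add: power_int_minus_left)
    have index: "6 * (5 * m + i) + 1 = 5 * (6 * m - 1) + 6 * (i + 1)" by simp
    show ?thesis unfolding sign index theta_term_dissection_5 by (simp only: mult_ac)
  qed
  have "dedekind_eta (\<tau> / 5) = (\<Sum>i\<in>{-3..<-3 + 5}. ?c (i + 1) * ?\<theta> (i + 1))"
  proof (rule has_sum_residue_classes)
    show "(?F has_sum dedekind_eta (\<tau> / 5)) UNIV"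
      using theta_char_has_sum[of "\<tau> / 5" "-1" 3 0 1] assms by (simp add: pentagonal_number_theorem)
    show "((\<lambda>m. ?F (5 * m + i)) has_sum ?c (i + 1) * ?\<theta> (i + 1)) UNIV" for i
      unfolding F_residue
      using theta_char_has_sum[of "5 * \<tau>" "-1" 3 "?x (i + 1)" "-1"] assms
      by (intro has_sum_cmult_right) simp
  qed simp
  also have "\<dots> = (\<Sum>j\<in>{-2..2}. ?c j * ?\<theta> j)"
    by (rule sum.reindex_bij_witness[where i = "\<lambda>j. j - 1" and j = "\<lambda>i. i + 1"]) auto
  finally show ?thesis .
qed

lemma dedekind_eta_div_5_quintuple_series:
  assumes "Im \<tau> > 0"
  shows "dedekind_eta (\<tau> / 5) = qpow \<tau> (3 / 10) * quintuple_series (5 * \<tau>) (of_real pi * \<tau>)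
      - dedekind_eta (5 * \<tau>) - qpow \<tau> (6 / 5) * quintuple_series (5 * \<tau>) (2 * of_real pi * \<tau>)"
proof -
  have "{-2..2} = {-2, -1, 0, 1, 2 :: int}" by auto
  moreover have "theta_char (5 * \<tau>) 3 (-1) (-1) x = theta_char (5 * \<tau>) 3 (-1) 1 (- x)" for x
    using theta_char_uminus[of "5 * \<tau>" "-1" 3 1 x] assms by simp
  ultimately show ?thesis
    unfolding dedekind_eta_div_5_theta_char[OF assms] using assms
    by (simp add: quintuple_series_def pentagonal_number_theorem power_int_minus algebra_simps)
qed

theorem dedekind_eta_div_5:
  assumes "Im \<tau> > 0"
  defines "v \<equiv> inverse_rogers_ramanujan \<tau>"
  shows "dedekind_eta (\<tau> / 5) = dedekind_eta (5 * \<tau>) * (v - 1 - 1 / v)"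
proof -
  have "1 / v = inverse (qpow \<tau> (3 / 10)) * (theta1_div5 \<tau> 1 / theta1_div5 \<tau> 2)"
    by (simp add: v_def inverse_rogers_ramanujan_def divide_simps)
  also have "inverse (qpow \<tau> (3 / 10)) = qpow \<tau> (6 / 5) * qpow \<tau> (- 3 / 2)"
    unfolding qpow_uminus[symmetric] qpow_add[symmetric] by (rule arg_cong) simp
  finally have "1 / v = qpow \<tau> (6 / 5) * qpow \<tau> (- 3 / 2) * (theta1_div5 \<tau> 1 / theta1_div5 \<tau> 2)" .
  thus ?thesis
    unfolding dedekind_eta_div_5_quintuple_series[OF assms(1)] quintuple_series_div5[OF assms(1)]
    by (simp add: v_def inverse_rogers_ramanujan_def algebra_simps)
qed

lemma prod_root_of_unity_quadratic:
  fixes \<omega> v :: complex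
  assumes "\<omega> ^ 5 = 1" "\<omega> \<noteq> 1" "v \<noteq> 0"
  shows "(\<Prod>k<5. \<omega> ^ k * v - 1 - 1 / (\<omega> ^ k * v)) = v ^ 5 - 11 - 1 / v ^ 5"
proof -
  \<comment> \<open>\<open>X - 1 - 1/X = (\<alpha> - X) (1 - \<alpha> - X) / X\<close> for the golden ratio \<open>\<alpha>\<close>\<close>
  define \<alpha> :: complex where "\<alpha> = (1 + of_real (sqrt 5)) / 2"
  have "(complex_of_real (sqrt 5)) ^ 2 = 5" by (simp flip: of_real_power)
  hence \<alpha>: "\<alpha> ^ 2 = \<alpha> + 1" by (simp add: \<alpha>_def power2_eq_square field_simps)
  have "\<omega> \<noteq> 0" using assms(1) by auto
  have factor: "\<omega> ^ k * v - 1 - 1 / (\<omega> ^ k * v) =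
      (-1) * ((\<alpha> - \<omega> ^ k * v) * ((1 - \<alpha>) - \<omega> ^ k * v) / (0 - \<omega> ^ k * v))" for k
  proof -
    have "(\<alpha> - X) * ((1 - \<alpha>) - X) = X * X - X - 1" for X using \<alpha> by algebra
    thus ?thesis using \<open>\<omega> \<noteq> 0\<close> assms(3) by (simp add: diff_divide_distrib)
  qed
  have product: "(\<Prod>k<5. c - \<omega> ^ k * v) = c ^ 5 - v ^ 5" for c
    using assms by (intro prod_minus_power_root_of_unity) simp_all
  have "(\<Prod>k<5. \<omega> ^ k * v - 1 - 1 / (\<omega> ^ k * v)) =
      (-1) ^ 5 * ((\<alpha> ^ 5 - v ^ 5) * ((1 - \<alpha>) ^ 5 - v ^ 5) / (0 ^ 5 - v ^ 5))"
    unfolding factor prod.distrib prod_dividef product by simp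
  also have "(\<alpha> ^ 5 - v ^ 5) * ((1 - \<alpha>) ^ 5 - v ^ 5) = v ^ 5 * v ^ 5 - 11 * v ^ 5 - 1"
    using \<alpha> by algebra
  also have "(-1) ^ 5 * ((v ^ 5 * v ^ 5 - 11 * v ^ 5 - 1) / (0 ^ 5 - v ^ 5)) =
      v ^ 5 - 11 - 1 / v ^ 5"
    using assms(3) by (simp add: field_simps)
  finally show ?thesis .
qed

lemma inverse_rogers_ramanujan_add_24_nat:
  assumes "Im \<tau> > 0"
  shows "inverse_rogers_ramanujan (\<tau> + 24 * of_nat k) =
    qpow (of_real 24) (3 / 10) ^ k * inverse_rogers_ramanujan \<tau>"
proof -
  have "theta1_div5 (\<tau> + 24 * of_nat k) j = theta1_div5 \<tau> j" for j
  proof -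
    have "of_int j * of_real pi * (\<tau> + 24 * of_nat k) =
        of_int j * of_real pi * \<tau> + of_int (24 * j * int k) * of_real pi"
      and "5 * (\<tau> + 24 * of_nat k) = 5 * \<tau> + 8 * of_int (15 * int k)"
      by (simp_all add: algebra_simps)
    moreover have "(-1 :: complex) powi (24 * j * int k) = 1" by (simp add: power_int_minus_left)
    moreover have "Im (5 * \<tau>) > 0" using assms by simp
    ultimately show ?thesis
      unfolding theta1_div5_def by (simp only: theta1_add_8_int theta1_add_int_pi mult_1)
  qed
  thus ?thesis
    using qpow_translate_24_divide[of \<tau> k 1] by (simp add: inverse_rogers_ramanujan_def)
qed

theorem rogers_ramanujan_fifth_power:
  assumes "Im \<tau> > 0"
  defines "v \<equiv> inverse_rogers_ramanujan \<tau>"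
  shows "dedekind_eta \<tau> ^ 6 = dedekind_eta (5 * \<tau>) ^ 6 * (v ^ 5 - 11 - 1 / v ^ 5)"
proof -
  define \<zeta> where "\<zeta> = qpow (of_real 24) (3 / 10)"
  have \<zeta>: "\<zeta> ^ 5 = 1" unfolding \<zeta>_def qpow_power qpow_of_real_eq_1_iff by simp
  have "\<zeta> \<noteq> 1"
  proof
    assume "\<zeta> = 1"
    then obtain n where "36 / 5 = real_of_int n"
      unfolding \<zeta>_def qpow_of_real_eq_1_iff by (auto elim: Ints_cases)
    hence "36 = 5 * n" by linarith
    thus False by presburger
  qed
  have "dedekind_eta ((\<tau> + 24 * of_nat k) / 5) =
      dedekind_eta (5 * \<tau>) * (\<zeta> ^ k * v - 1 - 1 / (\<zeta> ^ k * v))" for k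
  proof -
    have "5 * (\<tau> + 24 * of_nat k) = 5 * \<tau> + 24 * of_nat (5 * k)" by simp
    hence "dedekind_eta (5 * (\<tau> + 24 * of_nat k)) = dedekind_eta (5 * \<tau>)"
      by (simp only: dedekind_eta_add_24_nat)
    moreover have "Im (\<tau> + 24 * of_nat k) > 0" using assms(1) by simp
    ultimately show ?thesis
      by (simp add: dedekind_eta_div_5 inverse_rogers_ramanujan_add_24_nat[OF assms(1)] \<zeta>_def v_def)
  qed
  hence "dedekind_eta \<tau> ^ 6 =
      (\<Prod>k<5. dedekind_eta (5 * \<tau>) * (\<zeta> ^ k * v - 1 - 1 / (\<zeta> ^ k * v))) * dedekind_eta (5 * \<tau>)"
    using prod_dedekind_eta_translates[OF assms(1), of 5] by simp
  also have "\<dots> = dedekind_eta (5 * \<tau>) ^ 5 * (v ^ 5 - 11 - 1 / v ^ 5) * dedekind_eta (5 * \<tau>)"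
    unfolding prod.distrib
    using prod_root_of_unity_quadratic[OF \<zeta> \<open>\<zeta> \<noteq> 1\<close>, of v]
      inverse_rogers_ramanujan_nonzero[OF assms(1)]
    by (simp add: v_def)
  finally show ?thesis by (simp add: eval_nat_numeral)
qed

corollary dedekind_eta_combination_rogers_ramanujan:
  assumes "Im \<tau> > 0"
  defines "v \<equiv> inverse_rogers_ramanujan \<tau>"
  shows "10 * dedekind_eta \<tau> ^ 4 * dedekind_eta (5 * \<tau>) ^ 4
      + dedekind_eta \<tau> ^ 10 / dedekind_eta (5 * \<tau>) ^ 2 =
    (dedekind_eta \<tau> * dedekind_eta (5 * \<tau>)) ^ 4 * (v ^ 5 - 1 - 1 / v ^ 5)"
proof -
  define E H where "E = dedekind_eta \<tau>" and "H = dedekind_eta (5 * \<tau>)"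
  have H: "H \<noteq> 0" unfolding H_def using assms(1) by (intro dedekind_eta_nonzero) simp
  have "E ^ 10 = E ^ 4 * E ^ 6" by (simp flip: power_add)
  also have "E ^ 6 = H ^ 6 * (v ^ 5 - 11 - 1 / v ^ 5)"
    unfolding E_def H_def v_def by (rule rogers_ramanujan_fifth_power[OF assms(1)])
  also have "E ^ 4 * (H ^ 6 * (v ^ 5 - 11 - 1 / v ^ 5)) =
      E ^ 4 * H ^ 4 * (v ^ 5 - 11 - 1 / v ^ 5) * H ^ 2"
    by (simp add: eval_nat_numeral mult_ac)
  finally have "E ^ 10 / H ^ 2 = E ^ 4 * H ^ 4 * (v ^ 5 - 11 - 1 / v ^ 5)" using H by simp
  thus ?thesis unfolding E_def[symmetric] H_def[symmetric]
    by (simp add: power_mult_distrib algebra_simps)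
qed

section \<open>Alternating forms\<close>

lemma alternating_forms_proportional:
  fixes D R :: "'a \<Rightarrow> 'a \<Rightarrow> 'b::field_char_0"
  assumes plane: "\<And>f. f \<in> V \<Longrightarrow> \<exists>\<alpha> \<beta>. \<forall>x. f x = \<alpha> * p x + \<beta> * r x"
    and D: "\<And>y. (\<lambda>x. D x y) \<in> V" "\<And>x y. D x y = - D y x"
    and R: "\<And>y. (\<lambda>x. R x y) \<in> V" "\<And>x y. R x y = - R y x"
    and nonzero: "R u v \<noteq> 0"
  shows "D x y * R u v = R x y * D u v"
proof -
  \<comment> \<open>\<open>R(\<cdot>, u)\<close> and \<open>R(\<cdot>, v)\<close> form a basis of the plane dual to the evaluations at \<open>v\<close> and \<open>u\<close>.\<close>
  have interpolation: "f x * R u v = f u * R x v - f v * R x u" if V: "f \<in> V" for f x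
  proof -
    define g h where "g = (\<lambda>x. R x v)" and "h = (\<lambda>x. R x u)"
    obtain \<alpha> \<beta> where f: "\<And>x. f x = \<alpha> * p x + \<beta> * r x" using plane[OF V] by blast
    obtain \<gamma> \<delta> where g: "\<And>x. g x = \<gamma> * p x + \<delta> * r x"
      using plane[OF R(1)] unfolding g_def by blast
    obtain \<epsilon> \<zeta> where h: "\<And>x. h x = \<epsilon> * p x + \<zeta> * r x"
      using plane[OF R(1)] unfolding h_def by blast
    have "f x * (g u * h v - g v * h u) - g x * (f u * h v - f v * h u) +
        h x * (f u * g v - f v * g u) = 0"
      unfolding f g h by (simp add: algebra_simps)
    moreover have "g u = R u v" "g v = 0" "h u = 0" "h v = - R u v"
      using R(2)[of u u] R(2)[of v v] R(2)[of v u] by (simp_all add: g_def h_def)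
    ultimately have "R u v * (f x * R u v) = R u v * (f u * g x - f v * h x)"
      by (simp add: algebra_simps)
    thus ?thesis using nonzero by (simp add: g_def h_def)
  qed
  have expansion: "F x y * R u v * R u v = F u v * (R x u * R y v - R x v * R y u)"
    if F: "\<And>y. (\<lambda>x. F x y) \<in> V" "\<And>x y. F x y = - F y x" for F
  proof -
    have "F x y * R u v = F u y * R x v - F v y * R x u" by (rule interpolation[OF F(1)])
    moreover have "F u y * R u v = - F u v * R y u" "F v y * R u v = - F u v * R y v"
      using interpolation[OF F(1), of y u] interpolation[OF F(1), of y v] F(2)[of u u] F(2)[of v v]
        F(2)[of u y] F(2)[of v y] F(2)[of v u] by simp_all
    ultimately show ?thesis by algebra
  qed
  have "R u v * R u v * (D x y * R u v) = R u v * R u v * (R x y * D u v)"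
    using expansion[of D, OF D] expansion[of R, OF R] by algebra
  thus ?thesis using nonzero by simp
qed

section \<open>The theta function identity\<close>

definition theta1_twist :: "complex \<Rightarrow> int \<Rightarrow> complex \<Rightarrow> complex" where
  "theta1_twist \<tau> j x =
     exp (2 * of_int j * \<i> * x) * theta1 (x + of_int j * of_real pi * \<tau>) (5 * \<tau>) ^ 5
     - exp (- 2 * of_int j * \<i> * x) * theta1 (x - of_int j * of_real pi * \<tau>) (5 * \<tau>) ^ 5"

definition theta1_twist_form :: "complex \<Rightarrow> complex \<Rightarrow> complex \<Rightarrow> complex" where
  "theta1_twist_form \<tau> x y =
     theta1_twist \<tau> 1 x * theta1_twist \<tau> 2 y - theta1_twist \<tau> 1 y * theta1_twist \<tau> 2 x"

definition theta1_quintuple_form :: "complex \<Rightarrow> complex \<Rightarrow> complex \<Rightarrow> complex" where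
  "theta1_quintuple_form T x y =
     theta1 (x + y) T * theta1 (x - y) T * quintuple_series T x * quintuple_series T y"

lemma theta1_twist_in_symmetric_theta_space:
  assumes "Im \<tau> > 0"
  shows "theta1_twist \<tau> j \<in> symmetric_theta_space (5 * \<tau>) 5 (-1) 1 1"
proof -
  have T: "Im (5 * \<tau>) > 0" using assms by simp
  let ?u = "of_int j * of_real pi * \<tau>"
  define g where "g = (\<lambda>x. exp (2 * of_int j * \<i> * x) * theta1 (x + ?u) (5 * \<tau>) ^ 5)"
  have "(\<lambda>x. theta1 x (5 * \<tau>) ^ 5) \<in> theta_space (5 * \<tau>) 5 (-1) 5"
    using theta_space_power[OF theta_space_theta1[OF T], of 4] by simp
  from theta_space_quasi_shift[OF this, of "2 * j"]
  have "g \<in> theta_space (5 * \<tau>) 5 (-1) (5 + 2 * j)"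
    by (simp add: g_def mult_ac)
  hence g: "g \<in> theta_space (5 * \<tau>) 5 (-1) 1"
    using theta_space_cong_parity[of "5 + 2 * j" 1] by simp
  have twist: "theta1_twist \<tau> j = (\<lambda>x. g x + g (- x))"
  proof
    fix x
    have "- x + ?u = - (x - ?u)" by simp
    hence "theta1 (- x + ?u) (5 * \<tau>) = - theta1 (x - ?u) (5 * \<tau>)"
      by (simp only: theta1_uminus[OF T])
    thus "theta1_twist \<tau> j x = g x + g (- x)" by (simp add: theta1_twist_def g_def)
  qed
  have "(\<lambda>x. g x + g (- x)) \<in> theta_space (5 * \<tau>) 5 (-1) 1"
    using theta_space_add[OF g] theta_space_uminus_arg[OF g] by simp
  thus ?thesis unfolding twist by (simp add: symmetric_theta_space_def add.commute)
qed

lemma theta1_twist_form_in_symmetric_theta_space: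
  assumes "Im \<tau> > 0"
  shows "(\<lambda>x. theta1_twist_form \<tau> x y) \<in> symmetric_theta_space (5 * \<tau>) 5 (-1) 1 1"
proof -
  have "(\<lambda>x. theta1_twist \<tau> 2 y * theta1_twist \<tau> 1 x + (- theta1_twist \<tau> 1 y) * theta1_twist \<tau> 2 x)
      \<in> theta_space (5 * \<tau>) 5 (-1) 1"
    using theta1_twist_in_symmetric_theta_space[OF assms]
    by (intro theta_space_add theta_space_cmult) (simp_all add: symmetric_theta_space_def)
  thus ?thesis
    using theta1_twist_in_symmetric_theta_space[OF assms]
    by (simp add: symmetric_theta_space_def theta1_twist_form_def mult.commute)
qed

lemma theta1_quintuple_form_in_symmetric_theta_space:
  assumes "Im T > 0"
  shows "(\<lambda>x. theta1_quintuple_form T x y) \<in> symmetric_theta_space T 5 (-1) 1 1"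
proof -
  have shift: "(\<lambda>x. theta1 (x + z) T) \<in> theta_space T 1 (- exp (2 * \<i> * z)) 1" for z
    using theta_space_shift[OF theta_space_theta1[OF assms]] by simp
  have "(\<lambda>x. theta1 (x + y) T * theta1 (x + - y) T * quintuple_series T x) \<in>
      theta_space T (1 + 1 + 3) (- exp (2 * \<i> * y) * - exp (2 * \<i> * - y) * - 1) (1 + 1 + 1)"
    by (intro theta_space_mult shift theta_space_quintuple_series assms) auto
  also have "- exp (2 * \<i> * y) * - exp (2 * \<i> * - y) * - 1 = -1"
    by (simp flip: exp_add)
  finally have "(\<lambda>x. theta1 (x + y) T * theta1 (x - y) T * quintuple_series T x) \<in>
      theta_space T 5 (-1) 1"
    using theta_space_cong_parity[of 3 1] by simp
  from theta_space_cmult[OF this, of "quintuple_series T y"]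
  have "(\<lambda>x. theta1_quintuple_form T x y) \<in> theta_space T 5 (-1) 1"
    by (simp add: theta1_quintuple_form_def mult_ac)
  moreover have "theta1_quintuple_form T (- x) y = theta1_quintuple_form T x y" for x
  proof -
    have "- x + y = - (x - y)" "- x - y = - (x + y)" by simp_all
    thus ?thesis
      unfolding theta1_quintuple_form_def
      by (simp only: theta1_uminus[OF assms] quintuple_series_uminus) simp
  qed
  ultimately show ?thesis by (simp add: symmetric_theta_space_def)
qed

lemma theta1_quintuple_form_swap:
  assumes "Im T > 0"
  shows "theta1_quintuple_form T x y = - theta1_quintuple_form T y x"
proof -
  have "theta1 (y - x) T = - theta1 (x - y) T"
    using theta1_uminus[OF assms, of "x - y"] by (simp only: minus_diff_eq)
  thus ?thesis by (simp add: theta1_quintuple_form_def add.commute)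
qed

lemma theta_forms_proportional:
  assumes "Im \<tau> > 0" "theta1_quintuple_form (5 * \<tau>) u v \<noteq> 0"
  shows "theta1_twist_form \<tau> x y * theta1_quintuple_form (5 * \<tau>) u v =
    theta1_quintuple_form (5 * \<tau>) x y * theta1_twist_form \<tau> u v"
proof -
  have T: "Im (5 * \<tau>) > 0" using assms by simp
  obtain p r where "\<And>f. f \<in> symmetric_theta_space (5 * \<tau>) 5 (-1) 1 1 \<Longrightarrow>
      \<exists>\<alpha> \<beta>. \<forall>x. f x = \<alpha> * p x + \<beta> * r x"
    using even_theta_space_5_plane[OF T] by blast
  thus ?thesis
  proof (rule alternating_forms_proportional[where V = "symmetric_theta_space (5 * \<tau>) 5 (-1) 1 1"
        and D = "theta1_twist_form \<tau>" and R = "theta1_quintuple_form (5 * \<tau>)"])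
    show "theta1_twist_form \<tau> x y = - theta1_twist_form \<tau> y x" for x y
      by (simp add: theta1_twist_form_def)
  qed (assumption | rule theta1_twist_form_in_symmetric_theta_space
      theta1_quintuple_form_in_symmetric_theta_space theta1_quintuple_form_swap assms T)+
qed

lemma theta1_twist_div5:
  "theta1_twist \<tau> j (of_int k * of_real pi * \<tau>) =
    qpow \<tau> (real_of_int (j * k)) * theta1_div5 \<tau> (k + j) ^ 5
    - qpow \<tau> (- real_of_int (j * k)) * theta1_div5 \<tau> (k - j) ^ 5"
proof -
  have "exp (2 * of_int j * \<i> * (of_int k * of_real pi * \<tau>)) = qpow \<tau> (real_of_int (j * k))"
    "exp (- 2 * of_int j * \<i> * (of_int k * of_real pi * \<tau>)) = qpow \<tau> (- real_of_int (j * k))"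
    using exp_2_i_multiple_pi_tau[of "j * k" \<tau>] exp_2_i_multiple_pi_tau[of "- (j * k)" \<tau>]
    by (simp_all add: mult_ac)
  thus ?thesis by (simp add: theta1_twist_def theta1_div5_def algebra_simps)
qed

lemma theta1_quintuple_form_div5:
  assumes "Im \<tau> > 0"
  shows "theta1_quintuple_form (5 * \<tau>) (of_real pi * \<tau>) (2 * of_real pi * \<tau>) =
    - qpow \<tau> (- 2) * dedekind_eta (5 * \<tau>) ^ 2 * (theta1_div5 \<tau> 1 * theta1_div5 \<tau> 2)"
proof -
  let ?\<theta> = "theta1_div5 \<tau>"
  have "?\<theta> 3 = qpow \<tau> (- 1 / 2) * ?\<theta> 2"
    using theta1_div5_reflect[OF assms, of 2] by simp
  moreover have "?\<theta> (-1) = - ?\<theta> 1" by (rule theta1_div5_uminus[OF assms])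
  moreover have "of_real pi * \<tau> + 2 * of_real pi * \<tau> = of_int 3 * of_real pi * \<tau>"
    "of_real pi * \<tau> - 2 * of_real pi * \<tau> = of_int (-1) * of_real pi * \<tau>" by simp_all
  ultimately have "theta1_quintuple_form (5 * \<tau>) (of_real pi * \<tau>) (2 * of_real pi * \<tau>) =
      (qpow \<tau> (- 1 / 2) * ?\<theta> 2) * (- ?\<theta> 1) * (dedekind_eta (5 * \<tau>) * ?\<theta> 2 / ?\<theta> 1) *
      (dedekind_eta (5 * \<tau>) * qpow \<tau> (- 3 / 2) * ?\<theta> 1 / ?\<theta> 2)"
    unfolding theta1_quintuple_form_def quintuple_series_div5[OF assms]
    by (simp only: theta1_div5_def)
  also have "\<dots> = - (qpow \<tau> (- 1 / 2) * qpow \<tau> (- 3 / 2)) * dedekind_eta (5 * \<tau>) ^ 2 * (?\<theta> 1 * ?\<theta> 2)"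
    using theta1_div5_nonzero[OF assms, of 1] theta1_div5_nonzero[OF assms, of 2]
    by (simp add: power2_eq_square)
  also have "qpow \<tau> (- 1 / 2) * qpow \<tau> (- 3 / 2) = qpow \<tau> (- 2)"
    unfolding qpow_add[symmetric] by simp
  finally show ?thesis .
qed

lemma theta1_twist_form_div5:
  assumes "Im \<tau> > 0"
  defines "v \<equiv> inverse_rogers_ramanujan \<tau>"
  shows "qpow \<tau> (5 / 2) * theta1_twist_form \<tau> (of_real pi * \<tau>) (2 * of_real pi * \<tau>) =
    - ((theta1_div5 \<tau> 1 * theta1_div5 \<tau> 2) ^ 5) * (v ^ 5 - 1 - 1 / v ^ 5)"
proof -
  define a b e where "a = theta1_div5 \<tau> 1" and "b = theta1_div5 \<tau> 2" and "e = qpow \<tau> (1 / 2)"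
  have nonzero: "a \<noteq> 0" "b \<noteq> 0" "e \<noteq> 0"
    using theta1_div5_nonzero[OF assms(1)] by (simp_all add: a_def b_def e_def)
  have e_power: "qpow \<tau> (real n / 2) = e ^ n" for n by (simp add: e_def qpow_power)
  have e: "qpow \<tau> 1 = e ^ 2" "qpow \<tau> (3 / 2) = e ^ 3" "qpow \<tau> 2 = e ^ 4"
    "qpow \<tau> (5 / 2) = e ^ 5" "qpow \<tau> 4 = e ^ 8"
    using e_power[of 2] e_power[of 3] e_power[of 4] e_power[of 5] e_power[of 8] by simp_all
  have e_inverse: "qpow \<tau> (- (1 / 2)) = 1 / e" "qpow \<tau> (- (3 / 2)) = 1 / e ^ 3"
    "qpow \<tau> (- 2) = 1 / e ^ 4"
    unfolding qpow_uminus e e_def[symmetric] by (simp_all add: divide_inverse)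
  have div5: "theta1_div5 \<tau> 0 = 0" "theta1_div5 \<tau> (-1) = - a"
    "theta1_div5 \<tau> 3 = b / e" "theta1_div5 \<tau> 4 = a / e ^ 3"
    using theta1_div5_0[OF assms(1)] theta1_div5_uminus[OF assms(1), of 1]
      theta1_div5_reflect[OF assms(1), of 2] theta1_div5_reflect[OF assms(1), of 1]
    by (simp_all add: a_def b_def e_inverse)
  have twist: "theta1_twist \<tau> 1 (of_real pi * \<tau>) = e ^ 2 * b ^ 5"
    "theta1_twist \<tau> 1 (2 * of_real pi * \<tau>) = e ^ 4 * (b / e) ^ 5 - a ^ 5 / e ^ 4"
    "theta1_twist \<tau> 2 (of_real pi * \<tau>) = e ^ 4 * (b / e) ^ 5 + a ^ 5 / e ^ 4"
    "theta1_twist \<tau> 2 (2 * of_real pi * \<tau>) = e ^ 8 * (a / e ^ 3) ^ 5"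
    using theta1_twist_div5[of \<tau> 1 1] theta1_twist_div5[of \<tau> 1 2] theta1_twist_div5[of \<tau> 2 1]
      theta1_twist_div5[of \<tau> 2 2]
    by (simp_all add: e e_inverse div5 flip: a_def b_def)
  have v: "v ^ 5 = e ^ 3 * b ^ 5 / a ^ 5"
    by (simp add: v_def inverse_rogers_ramanujan_def a_def b_def power_divide
        power_mult_distrib qpow_power e)
  have "qpow \<tau> (5 / 2) * theta1_twist_form \<tau> (of_real pi * \<tau>) (2 * of_real pi * \<tau>) =
      (a * b) ^ 5 - e ^ 3 * b ^ 10 + a ^ 10 / e ^ 3"
    unfolding theta1_twist_form_def twist e using nonzero(3)
    by (simp add: field_simps eval_nat_numeral)
  also have "\<dots> = - ((a * b) ^ 5) * (v ^ 5 - 1 - 1 / v ^ 5)"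
    unfolding v using nonzero by (simp add: field_simps eval_nat_numeral)
  finally show ?thesis by (simp add: a_def b_def)
qed

theorem theta1_twist_form_eq_quintuple_form:
  assumes "Im \<tau> > 0"
  shows "qpow \<tau> (5 / 2) * theta1_twist_form \<tau> x y * dedekind_eta (5 * \<tau>) ^ 2 =
    (10 * dedekind_eta \<tau> ^ 4 * dedekind_eta (5 * \<tau>) ^ 4
      + dedekind_eta \<tau> ^ 10 / dedekind_eta (5 * \<tau>) ^ 2) *
    theta1_quintuple_form (5 * \<tau>) x y"
proof -
  define E H where "E = dedekind_eta \<tau>" and "H = dedekind_eta (5 * \<tau>)"
  define P where "P = theta1_div5 \<tau> 1 * theta1_div5 \<tau> 2"
  define w where "w = inverse_rogers_ramanujan \<tau> ^ 5 - 1 - 1 / inverse_rogers_ramanujan \<tau> ^ 5"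
  let ?D = "theta1_twist_form \<tau>" and ?R = "theta1_quintuple_form (5 * \<tau>)"
  let ?u = "of_real pi * \<tau>" and ?v = "2 * of_real pi * \<tau>"
  have nonzero: "H \<noteq> 0" "P \<noteq> 0"
    unfolding H_def P_def using theta1_div5_nonzero[OF assms] assms
    by (simp_all add: dedekind_eta_nonzero)
  have R: "?R ?u ?v = - qpow \<tau> (- 2) * H ^ 2 * P"
    unfolding H_def P_def by (rule theta1_quintuple_form_div5[OF assms])
  have D: "qpow \<tau> (5 / 2) * ?D ?u ?v = - (P ^ 5) * w"
    unfolding P_def w_def by (rule theta1_twist_form_div5[OF assms])
  have "P = - (qpow \<tau> (- 1 / 2) * (E * H))"
    unfolding P_def E_def H_def theta1_div5_1_mult_2[OF assms] by simp
  hence "P ^ 4 = qpow \<tau> (- 2) * (E * H) ^ 4" by (simp add: power_mult_distrib qpow_power)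
  moreover have "P ^ 5 = P ^ 4 * P" by (simp add: eval_nat_numeral)
  ultimately have P_power_5: "P ^ 5 = qpow \<tau> (- 2) * (E * H) ^ 4 * P" by simp
  have R_nonzero: "?R ?u ?v \<noteq> 0" unfolding R using nonzero by simp
  have "(qpow \<tau> (5 / 2) * ?D x y * H ^ 2) * ?R ?u ?v =
      ?R x y * (qpow \<tau> (5 / 2) * ?D ?u ?v) * H ^ 2"
    using theta_forms_proportional[OF assms R_nonzero, of x y] by (simp add: mult_ac)
  also have "\<dots> = ((E * H) ^ 4 * w * ?R x y) * ?R ?u ?v"
    unfolding D R P_power_5 by (simp add: mult_ac)
  finally show ?thesis
    using R_nonzero dedekind_eta_combination_rogers_ramanujan[OF assms]
    by (simp add: E_def H_def w_def)
qed

theorem theorem4p6: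
  fixes \<tau> x y :: complex
  assumes "Im \<tau> > 0"
    and "theta1 x (5 * \<tau>) * theta1 y (5 * \<tau>) \<noteq> 0"
  shows "qpow \<tau> (5 / 2)
        * (exp (2 * \<i> * x) * theta1 (x + of_real pi * \<tau>) (5 * \<tau>) ^ 5
           - exp (- 2 * \<i> * x) * theta1 (x - of_real pi * \<tau>) (5 * \<tau>) ^ 5)
        * (exp (4 * \<i> * y) * theta1 (y + 2 * of_real pi * \<tau>) (5 * \<tau>) ^ 5
           - exp (- 4 * \<i> * y) * theta1 (y - 2 * of_real pi * \<tau>) (5 * \<tau>) ^ 5)
      - qpow \<tau> (5 / 2)
        * (exp (2 * \<i> * y) * theta1 (y + of_real pi * \<tau>) (5 * \<tau>) ^ 5
           - exp (- 2 * \<i> * y) * theta1 (y - of_real pi * \<tau>) (5 * \<tau>) ^ 5)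
        * (exp (4 * \<i> * x) * theta1 (x + 2 * of_real pi * \<tau>) (5 * \<tau>) ^ 5
           - exp (- 4 * \<i> * x) * theta1 (x - 2 * of_real pi * \<tau>) (5 * \<tau>) ^ 5)
    = (10 * dedekind_eta \<tau> ^ 4 * dedekind_eta (5 * \<tau>) ^ 4
         + dedekind_eta \<tau> ^ 10 / dedekind_eta (5 * \<tau>) ^ 2)
      * ((theta1 (x + y) (5 * \<tau>) * theta1 (x - y) (5 * \<tau>)
            * theta1 (2 * x) (5 * \<tau>) * theta1 (2 * y) (5 * \<tau>))
         / (theta1 x (5 * \<tau>) * theta1 y (5 * \<tau>)))"
    (is "?lhs = ?C * ?rhs")
proof -
  define H where "H = dedekind_eta (5 * \<tau>)"
  have T: "Im (5 * \<tau>) > 0" using assms(1) by simp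
  have H: "H \<noteq> 0" unfolding H_def by (rule dedekind_eta_nonzero[OF T])
  have "quintuple_series (5 * \<tau>) z = H * theta1 (2 * z) (5 * \<tau>) / theta1 z (5 * \<tau>)"
    if "theta1 z (5 * \<tau>) \<noteq> 0" for z
    using quintuple_product_identity[OF T, of z] that by (simp add: H_def field_simps)
  hence "theta1_quintuple_form (5 * \<tau>) x y = H ^ 2 * ?rhs"
    using assms(2) by (simp add: theta1_quintuple_form_def power2_eq_square)
  moreover have "exp (2 * \<i> * z) * theta1 (z + of_real pi * \<tau>) (5 * \<tau>) ^ 5
      - exp (- 2 * \<i> * z) * theta1 (z - of_real pi * \<tau>) (5 * \<tau>) ^ 5 = theta1_twist \<tau> 1 z"
    "exp (4 * \<i> * z) * theta1 (z + 2 * of_real pi * \<tau>) (5 * \<tau>) ^ 5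
      - exp (- 4 * \<i> * z) * theta1 (z - 2 * of_real pi * \<tau>) (5 * \<tau>) ^ 5 = theta1_twist \<tau> 2 z" for z
    by (simp_all add: theta1_twist_def)
  hence "?lhs = qpow \<tau> (5 / 2) * theta1_twist_form \<tau> x y"
    by (simp only: theta1_twist_form_def right_diff_distrib mult.assoc)
  ultimately have "?lhs * H ^ 2 = ?C * ?rhs * H ^ 2"
    using theta1_twist_form_eq_quintuple_form[OF assms(1), of x y] unfolding H_def
    by (simp only: mult_ac)
  thus ?thesis using H by (subst (asm) mult_right_cancel) simp_all
qed

end
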